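(* Let $S$ be a countable set and let $p \in (1,\infty]$. Let $\{U^{(p)}(s)\}_{s\in S}$ be a collection of independent random variables with distribution function $\Phi_p$. Let $\sum_{i\in\mathbb{N}}\delta_{A_i}$ be a Poisson point process on $(0,\infty)$ with intensity measure $a^{-2}\,\mathrm{d}a$, and let $W_i^{(p)}$, $i\in\mathbb{N}$, be independent copies of a non-negative stochastic process $\{W^{(p)}(s),\ s\in S\}$ with $\mathbb{E}\{W^{(p)}(s)\}=1$ for all $s\in S$, where $\{U^{(p)}(s)\}_{s\in S}$, $\{A_i\}_{i\in\mathbb{N}}$ and $\{W_i^{(p)}\}_{i\in\mathbb{N}}$ are independent of each other. Then the process $X=\{X(s),\ s\in S\}$ defined by $$X(s)=\frac{U^{(p)}(s)}{\Gamma(1-p^{-1})}\,\|\mathbf{A}\circ\mathbf{W}^{(p)}(s)\|_p,\qquad s\in S,$$ is simple max-stable.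
   Context: For $\alpha\in(0,\infty)$, $\Phi_\alpha(x)=\exp(-x^{-\alpha})$, $x>0$, is the $\alpha$-Fréchet distribution function; $\Phi_\infty(x)=\mathbf{1}_{[1,\infty)}(x)$, i.e. a $\Phi_\infty$ random variable equals $1$ almost surely. For $p=\infty$ we set $p^{-1}=0$. For sequences $\mathbf{A}=\{A_i\}_{i\in\mathbb{N}}$ and $\mathbf{W}^{(p)}(s)=\{W^{(p)}_i(s)\}_{i\in\mathbb{N}}$ of non-negative numbers, $\|\mathbf{A}\circ\mathbf{W}^{(p)}(s)\|_p=\left[\sum_{i\in\mathbb{N}}(A_iW^{(p)}_i(s))^p\right]^{1/p}$ for $p\in(1,\infty)$, and $\|\mathbf{A}\circ\mathbf{W}^{(\infty)}(s)\|_\infty=\max_{i\in\mathbb{N}}A_iW^{(\infty)}_i(s)$. A stochastic process $X=\{X(s),\ s\in S\}$ is called max-stable if there exist functions $a_n:S\to(0,\infty)$ and $b_n:S\to\mathbb{R}$, $n\in\mathbb{N}$, such that for every $n\in\mathbb{N}$ the process $\max_{i=1}^n (X_i-b_n)/a_n$ (pointwise maximum; $X_1,X_2,\ldots$ independent copies of $X$) has the same law as $X$. It is called simple max-stable if in addition $X(s)$ has the unit Fréchet distribution function $\Phi_1$ for every $s\in S$. *)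

theory Defs
  imports "HOL-Probability.Probability"
begin

definition frechet_cdf :: "ereal \<Rightarrow> real \<Rightarrow> real" where
  "frechet_cdf \<alpha> x =
     (if \<alpha> = \<infinity> then indicator {1..} x
      else if 0 < x then exp (- (x powr (- real_of_ereal \<alpha>))) else 0)"

(* The sum and the supremum are formed in [0, \<infinity>] and then mapped to the reals, where an
   infinite norm becomes 0.  Processes built from this norm are therefore real-valued
   everywhere, and a unit Frechet law of such a process, having no atom at 0, is only possible
   if the norm is almost surely finite. *)
definition lp_norm :: "ereal \<Rightarrow> (nat \<Rightarrow> real) \<Rightarrow> real" where
  "lp_norm p x =
     (if p = \<infinity> then enn2real (SUP i. ennreal (x i))
      else enn2real (\<Sum>i. ennreal (x i powr real_of_ereal p)) powr (1 / real_of_ereal p))"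

definition process_law :: "'w measure \<Rightarrow> 's set \<Rightarrow> ('s \<Rightarrow> 'w \<Rightarrow> real) \<Rightarrow> ('s \<Rightarrow> real) measure" where
  "process_law M S X = distr M (PiM S (\<lambda>_. borel)) (\<lambda>\<omega>. \<lambda>s\<in>S. X s \<omega>)"

definition stochastic_process :: "'w measure \<Rightarrow> 's set \<Rightarrow> ('s \<Rightarrow> 'w \<Rightarrow> real) \<Rightarrow> bool" where
  "stochastic_process M S X \<longleftrightarrow> prob_space M \<and> (\<forall>s\<in>S. X s \<in> borel_measurable M)"

(* The sigma-algebra on the sample space generated by the process. *)
definition process_events :: "'w measure \<Rightarrow> 's set \<Rightarrow> ('s \<Rightarrow> 'w \<Rightarrow> real) \<Rightarrow> 'w set set" where
  "process_events M S X =
     {(\<lambda>\<omega>. \<lambda>s\<in>S. X s \<omega>) -` B \<inter> space M | B. B \<in> sets (PiM S (\<lambda>_. borel))}"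

(* The Y i, defined on M, are independent copies of the process X, defined on a possibly
   different probability space N. *)
definition independent_copies ::
    "'w measure \<Rightarrow> 's set \<Rightarrow> (nat \<Rightarrow> 's \<Rightarrow> 'w \<Rightarrow> real) \<Rightarrow> 'v measure \<Rightarrow> ('s \<Rightarrow> 'v \<Rightarrow> real) \<Rightarrow> bool" where
  "independent_copies M S Y N X \<longleftrightarrow>
     prob_space.indep_vars M (\<lambda>_. PiM S (\<lambda>_. borel)) (\<lambda>i \<omega>. \<lambda>s\<in>S. Y i s \<omega>) UNIV \<and>
     (\<forall>i. process_law M S (Y i) = process_law N S X)"

(* The n independent copies of X are realised on the n-fold product space: the i-th copy is
   X evaluated at the i-th coordinate.  The law of the maximum does not depend on the choice
   of the copies. *)
definition max_stable :: "'w measure \<Rightarrow> 's set \<Rightarrow> ('s \<Rightarrow> 'w \<Rightarrow> real) \<Rightarrow> bool" where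
  "max_stable M S X \<longleftrightarrow>
     stochastic_process M S X \<and>
     (\<exists>(a :: nat \<Rightarrow> 's \<Rightarrow> real) (b :: nat \<Rightarrow> 's \<Rightarrow> real).
        \<forall>n\<ge>1. (\<forall>s\<in>S. 0 < a n s) \<and>
          process_law (PiM {1..n} (\<lambda>_. M)) S (\<lambda>s \<omega>. MAX i\<in>{1..n}. (X s (\<omega> i) - b n s) / a n s)
            = process_law M S X)"

definition simple_max_stable :: "'w measure \<Rightarrow> 's set \<Rightarrow> ('s \<Rightarrow> 'w \<Rightarrow> real) \<Rightarrow> bool" where
  "simple_max_stable M S X \<longleftrightarrow>
     max_stable M S X \<and> (\<forall>s\<in>S. cdf (distr M borel (X s)) = frechet_cdf 1)"

definition dirac_sum :: "(nat \<Rightarrow> 'w \<Rightarrow> 'a) \<Rightarrow> 'a set \<Rightarrow> 'w \<Rightarrow> ennreal" where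
  "dirac_sum A B \<omega> = (\<Sum>i. indicator B (A i \<omega>))"

(* poisson_pmf is unspecified at rate 0, so the Poisson weights are written out; they include
   the null sets of the intensity (0 ^ 0 = 1). *)
definition poisson_point_process ::
    "'w measure \<Rightarrow> 'a measure \<Rightarrow> ('a set \<Rightarrow> 'w \<Rightarrow> ennreal) \<Rightarrow> bool" where
  "poisson_point_process M \<mu> \<xi> \<longleftrightarrow>
     (\<forall>B\<in>sets \<mu>. \<xi> B \<in> borel_measurable M) \<and>
     (\<forall>B\<in>sets \<mu>. emeasure \<mu> B < \<infinity> \<longrightarrow>
        (\<forall>k::nat. measure M {\<omega>\<in>space M. \<xi> B \<omega> = of_nat k}
           = measure \<mu> B ^ k / fact k * exp (- measure \<mu> B))) \<and>
     (\<forall>B\<in>sets \<mu>. emeasure \<mu> B = \<infinity> \<longrightarrow> (AE \<omega> in M. \<xi> B \<omega> = \<infinity>)) \<and>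
     (\<forall>(n::nat) B. (\<forall>j<n. B j \<in> sets \<mu>) \<and> disjoint_family_on B {..<n} \<longrightarrow>
        prob_space.indep_vars M (\<lambda>_. borel) (\<lambda>j. \<xi> (B j)) {..<n})"

definition frechet_intensity :: "real measure" where
  "frechet_intensity = density (restrict_space lborel {0<..}) (\<lambda>a. ennreal (1 / a\<^sup>2))"

end

theory Submission
  imports Defs
begin

text \<open>
  The proof computes all finite-dimensional distribution functions of $X$. Conditionally on the
  points $A_i$ and the marks $W_i$, the event $X(s) \le x(s)$ is
  $U(s)\,\|A \circ W(s)\|_p \le \gamma\, x(s)$ with $\gamma = \Gamma(1 - 1/p)$, and the
  $U(s)$ are independent with distribution function $\Phi_p$. The point of the Frechet law is the identity
  \[ \Phi_p(y / \|z\|_p) = \prod_i \Phi_p(y / z_i) , \]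
  for finite $p$ because both sides equal $\exp(-\sum_i (z_i / y)^p)$, and for $p = \infty$
  because $\sup_i z_i \le y$ means that every $z_i \le y$. It turns the conditional probability into
  a product over the points of the marked process $(A_i, W_i)$, whose expectation is a Laplace
  functional:
  \[ P(X(s) \le x(s), s \in J) = \exp(- V_J(x)), \qquad
     V_J(x) = E \int_0^\infty \Bigl(1 - \prod_{s \in J} \Phi_p\bigl(\gamma x(s) / (a W(s))\bigr)\Bigr) a^{-2}\, da . \]

  The substitution $a \mapsto t a$ in the measure $a^{-2} da$ shows that $V_J$ is homogeneous of
  degree $-1$. Hence the maximum of $n$ independent copies of $X$, divided by $n$, has
  the distribution function $\exp(- V_J(n x))^n = \exp(- V_J(x))$ of $X$. For a single $s$ the
  same substitution gives $V_{\{s\}}(x) = E(W(s)) / x = 1 / x$, the constant $\gamma$ being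
  the integral $\int_0^\infty (1 - \Phi_p(1/a)) a^{-2}\, da$. This is the unit Frechet law.

  Everything is carried out with integrals in $[0, \infty]$, writing
  $\prod_i \Phi_p(y / z_i)$ as $\exp(- \sum_i \varphi_p(z_i / y))$ with an exponent
  $\varphi_p$ (\<open>frechet_exponent\<close> below) that may be infinite. Only the facts about
  $\varphi_p$ itself then distinguish $p = \infty$ from finite $p$. The almost sure finiteness of the
  norm (\<open>AE_norm_finite\<close>) enters through \<open>suminf_frechet_exponent\<close>, which is the identity above.
  The steps are \<open>poisson_point_process_exp_neg\<close> (Laplace functional),
  \<open>marked_poisson_exp_neg\<close> (adding the marks), \<open>frechet_product_cdf\<close>
  (integrating out $U$), \<open>joint_cdf\<close> and \<open>joint_cdf_power\<close>.
\<close>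

section \<open>The exponential of the negative on extended non-negative reals\<close>

definition exp_neg :: "ennreal \<Rightarrow> ennreal" where
  "exp_neg x = (if x = \<top> then 0 else ennreal (exp (- enn2real x)))"

text \<open>
  A right inverse of \<^const>\<open>exp_neg\<close> on $[0, 1]$. It lets an infinite product of
  probabilities be written as \<^const>\<open>exp_neg\<close> of a sum.
\<close>
definition neg_ln :: "ennreal \<Rightarrow> ennreal" where
  "neg_ln t = (if t = 0 then \<top> else ennreal (- ln (enn2real t)))"

lemma exp_neg_top [simp]: "exp_neg \<top> = 0"
  and exp_neg_0 [simp]: "exp_neg 0 = 1"
  by (simp_all add: exp_neg_def)

lemma exp_neg_ennreal: "0 \<le> x \<Longrightarrow> exp_neg (ennreal x) = ennreal (exp (- x))"
  by (simp add: exp_neg_def)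

lemma exp_neg_le_1: "exp_neg x \<le> 1"
  by (simp add: exp_neg_def)

lemma exp_neg_less_top [simp]: "exp_neg x < \<top>" "exp_neg x \<noteq> \<top>"
  by (simp_all add: exp_neg_def)

lemma exp_neg_add: "exp_neg (x + y) = exp_neg x * exp_neg y"
proof (cases "x = \<top> \<or> y = \<top>")
  case False
  then show ?thesis
    by (cases x; cases y)
       (auto simp: exp_neg_ennreal ennreal_mult'[symmetric] mult_exp_exp simp flip: ennreal_plus)
qed auto

lemma exp_neg_sum: "exp_neg (\<Sum>i\<in>I. f i) = (\<Prod>i\<in>I. exp_neg (f i))"
  by (induction I rule: infinite_finite_induct) (auto simp: exp_neg_add)

lemma exp_neg_antimono: "x \<le> y \<Longrightarrow> exp_neg y \<le> exp_neg x"
  by (cases x; cases y) (auto simp: exp_neg_def top_unique)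

lemma exp_neg_neg_ln: "t \<le> 1 \<Longrightarrow> exp_neg (neg_ln t) = t"
  by (cases t) (auto simp: exp_neg_def neg_ln_def top_unique)

lemma tendsto_exp_neg:
  assumes "(f \<longlongrightarrow> x) F"
  shows "((\<lambda>a. exp_neg (f a)) \<longlongrightarrow> exp_neg x) F"
proof (cases "x = \<top>")
  case False
  have "eventually (\<lambda>a. f a < \<top>) F"
    using order_tendstoD(2)[OF assms] False by (simp add: less_top)
  then have "eventually (\<lambda>a. ennreal (exp (- enn2real (f a))) = exp_neg (f a)) F"
    by eventually_elim (simp add: exp_neg_def)
  moreover have "((\<lambda>a. ennreal (exp (- enn2real (f a)))) \<longlongrightarrow> ennreal (exp (- enn2real x))) F"
    by (intro tendsto_intros tendsto_ennrealI tendsto_enn2real) (use False assms in \<open>auto simp: less_top\<close>)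
  ultimately show ?thesis
    using False by (subst (2) exp_neg_def) (simp add: Lim_transform_eventually del: tendsto_ennreal_iff)
next
  case True
  show ?thesis unfolding True exp_neg_top
  proof (rule order_tendstoI)
    fix e :: ennreal assume "0 < e"
    then obtain r where r: "0 < ennreal r" "ennreal r < e" "0 < r"
    proof -
      obtain t where "0 < t" "t < e" using dense[OF \<open>0 < e\<close>] by blast
      then show ?thesis by (cases t) (auto intro: that simp: ennreal_less_zero_iff)
    qed
    have "eventually (\<lambda>a. ennreal (max 0 (- ln r)) < f a) F"
      using order_tendstoD(1)[OF assms] True by simp
    then show "eventually (\<lambda>a. exp_neg (f a) < e) F"
    proof eventually_elim
      case (elim a)
      have "exp_neg (f a) \<le> exp_neg (ennreal (max 0 (- ln r)))"
        using elim by (intro exp_neg_antimono) simp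
      also have "\<dots> \<le> ennreal r"
      proof -
        have "exp (- max 0 (- ln r)) \<le> exp (ln r)" by (subst exp_le_cancel_iff) simp
        then show ?thesis using r by (subst exp_neg_ennreal) (auto intro!: ennreal_leI)
      qed
      finally show ?case using r by simp
    qed
  qed simp
qed

lemma measurable_exp_neg [measurable]: "exp_neg \<in> borel_measurable borel"
  unfolding exp_neg_def by measurable

lemma measurable_neg_ln [measurable]: "neg_ln \<in> borel_measurable borel"
  unfolding neg_ln_def by measurable

lemma exp_neg_suminf:
  "(\<lambda>n. \<Prod>i<n. exp_neg (f i)) \<longlonglongrightarrow> exp_neg (\<Sum>i. f i)"
  unfolding exp_neg_sum[symmetric]
  by (intro tendsto_exp_neg) (simp add: summable_LIMSEQ)

text \<open>
  Since \<^const>\<open>exp_neg\<close> is continuous up to $\infty$ and bounded by 1, dominated convergence applies.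
\<close>
lemma nn_integral_exp_neg_tendsto:
  assumes "finite_measure M"
    and [measurable]: "\<And>n. X n \<in> borel_measurable M" "Y \<in> borel_measurable M"
    and lim: "AE \<omega> in M. (\<lambda>n. X n \<omega>) \<longlonglongrightarrow> Y \<omega>"
  shows "(\<lambda>n. \<integral>\<^sup>+\<omega>. exp_neg (X n \<omega>) \<partial>M) \<longlonglongrightarrow> (\<integral>\<^sup>+\<omega>. exp_neg (Y \<omega>) \<partial>M)"
proof (rule nn_integral_dominated_convergence[where w="\<lambda>_. 1"])
  interpret finite_measure M by fact
  show "(\<integral>\<^sup>+_. 1 \<partial>M) < \<infinity>" by (simp add: less_top[symmetric])
  show "AE \<omega> in M. (\<lambda>n. exp_neg (X n \<omega>)) \<longlonglongrightarrow> exp_neg (Y \<omega>)"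
    using lim by eventually_elim (rule tendsto_exp_neg)
qed (auto simp: exp_neg_le_1)

lemma (in prob_space) nn_integral_exp_neg_le_1: "(\<integral>\<^sup>+\<omega>. exp_neg (X \<omega>) \<partial>M) \<le> 1"
proof -
  have "(\<integral>\<^sup>+\<omega>. exp_neg (X \<omega>) \<partial>M) \<le> (\<integral>\<^sup>+\<omega>. 1 \<partial>M)"
    by (intro nn_integral_mono exp_neg_le_1)
  then show ?thesis by (simp add: emeasure_space_1)
qed

text \<open>
  The finite products factorise by independence, and passing to the limit keeps this because the partial
  sums of the exponents converge in $[0, \infty]$.
\<close>
lemma (in prob_space) nn_integral_exp_neg_suminf_indep:
  assumes indep: "indep_vars (\<lambda>_. borel) X (UNIV :: nat set)"
  shows "(\<integral>\<^sup>+\<omega>. exp_neg (\<Sum>i. X i \<omega>) \<partial>M) = exp_neg (\<Sum>i. neg_ln (\<integral>\<^sup>+\<omega>. exp_neg (X i \<omega>) \<partial>M))"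
proof -
  have [measurable]: "\<And>i. X i \<in> borel_measurable M"
    using indep by (auto simp: indep_vars_def)
  have "(\<lambda>n. \<integral>\<^sup>+\<omega>. exp_neg (\<Sum>i<n. X i \<omega>) \<partial>M) \<longlonglongrightarrow> (\<integral>\<^sup>+\<omega>. exp_neg (\<Sum>i. X i \<omega>) \<partial>M)"
    by (intro nn_integral_exp_neg_tendsto) (auto simp: summable_LIMSEQ finite_measure_axioms)
  moreover have "(\<integral>\<^sup>+\<omega>. exp_neg (\<Sum>i<n. X i \<omega>) \<partial>M)
      = (\<Prod>i<n. exp_neg (neg_ln (\<integral>\<^sup>+\<omega>. exp_neg (X i \<omega>) \<partial>M)))" for n
  proof -
    have "indep_vars (\<lambda>_. borel) (\<lambda>i \<omega>. exp_neg (X i \<omega>)) {..<n}"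
      by (rule indep_vars_compose2[OF indep_vars_subset[OF indep]]) auto
    from indep_vars_nn_integral[OF _ this] show ?thesis
      by (simp add: exp_neg_sum exp_neg_neg_ln nn_integral_exp_neg_le_1)
  qed
  ultimately show ?thesis
    using LIMSEQ_unique[OF _ exp_neg_suminf] by simp
qed

section \<open>The Laplace functional of a Poisson point process\<close>

text \<open>
  The probability generating function $E(q^Z) = \exp(- m (1 - q))$ of the Poisson distribution at
  $q = e^{-y}$, where $y = \infty$ is allowed and gives the void probability.
\<close>
lemma (in prob_space) poisson_exp_neg:
  assumes [measurable]: "Z \<in> borel_measurable M" and m: "0 \<le> m"
    and Z: "\<And>k::nat. prob {\<omega>\<in>space M. Z \<omega> = of_nat k} = m ^ k / fact k * exp (- m)"
  shows "(\<integral>\<^sup>+\<omega>. exp_neg (y * Z \<omega>) \<partial>M) = exp_neg (ennreal m * (1 - exp_neg y))"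
proof -
  obtain q where q: "exp_neg y = ennreal q" "0 \<le> q" "q \<le> 1"
    using exp_neg_le_1[of y] by (cases "exp_neg y") auto
  have pow: "exp_neg (y * of_nat k) = ennreal (q ^ k)" for k
  proof -
    have "exp_neg (y * of_nat k) = exp_neg (\<Sum>i<k. y)" by (simp add: mult.commute)
    also have "\<dots> = exp_neg y ^ k" by (subst exp_neg_sum) simp
    finally show ?thesis using q by (simp add: ennreal_power)
  qed
  have exps: "(\<lambda>k. x ^ k / fact k * exp (- m)) sums (exp x * exp (- m))" for x :: real
    using exp_converges[of x] by (intro sums_mult2) (simp add: field_simps scaleR_conv_of_real)
  define B where "B k = {\<omega>\<in>space M. Z \<omega> = of_nat k}" for k :: nat
  have [measurable]: "B k \<in> sets M" for k unfolding B_def by measurable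
  have disj: "disjoint_family B" by (auto simp: B_def disjoint_family_on_def)
  \<comment> \<open>The Poisson weights add up to one, so the count is almost surely a natural number.\<close>
  have "prob (\<Union>k. B k) = 1"
  proof -
    have "(\<lambda>k. prob (B k)) sums prob (\<Union>k. B k)"
      by (rule finite_measure_UNION) (auto simp: disj)
    moreover have "(\<lambda>k. prob (B k)) sums 1"
      using exps[of m] by (simp add: B_def Z exp_minus)
    ultimately show ?thesis by (rule sums_unique2)
  qed
  then have "AE \<omega> in M. \<omega> \<in> (\<Union>k. B k)" by (subst AE_in_set_eq_1) auto
  then have "(\<integral>\<^sup>+\<omega>. exp_neg (y * Z \<omega>) \<partial>M) = (\<integral>\<^sup>+\<omega>. (\<Sum>k. ennreal (q ^ k) * indicator (B k) \<omega>) \<partial>M)"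
  proof (intro nn_integral_cong_AE, eventually_elim)
    case (elim \<omega>)
    then obtain k where k: "\<omega> \<in> B k" by auto
    have other: "indicator (B j) \<omega> = (0 :: ennreal)" if "j \<noteq> k" for j
      using k disj that by (auto simp: disjoint_family_on_def indicator_def)
    have "(\<Sum>j. ennreal (q ^ j) * indicator (B j) \<omega>) = (\<Sum>j\<in>{k}. ennreal (q ^ j) * indicator (B j) \<omega>)"
      by (rule suminf_finite) (simp_all add: other)
    also have "\<dots> = ennreal (q ^ k)" using k by simp
    also have "\<dots> = exp_neg (y * Z \<omega>)" using k by (simp only: pow[symmetric]) (simp add: B_def)
    finally show ?case by simp
  qed
  also have "\<dots> = (\<Sum>k. ennreal (q ^ k) * emeasure M (B k))"
    by (subst nn_integral_suminf) (auto simp: nn_integral_cmult_indicator)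
  also have "\<dots> = (\<Sum>k. ennreal ((m * q) ^ k / fact k * exp (- m)))"
  proof -
    have "emeasure M (B k) = ennreal (m ^ k / fact k * exp (- m))" for k
      unfolding emeasure_eq_measure B_def Z ..
    then show ?thesis
      using q m by (simp add: ennreal_mult'[symmetric] power_mult_distrib mult_ac)
  qed
  also have "\<dots> = ennreal (exp (m * q) * exp (- m))"
    using exps[of "m * q"] q m by (intro suminf_ennreal_eq) auto
  also have "\<dots> = exp_neg (ennreal m * (1 - exp_neg y))"
  proof -
    have "ennreal m * (1 - exp_neg y) = ennreal (m * (1 - q))"
      using q m ennreal_minus[of q 1] by (simp add: ennreal_mult')
    moreover have "exp (m * q) * exp (- m) = exp (- (m * (1 - q)))"
      by (simp add: mult_exp_exp algebra_simps)
    ultimately show ?thesis using q m by (simp add: exp_neg_ennreal)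
  qed
  finally show ?thesis .
qed

text \<open>
  The Laplace functional at a step function. On a set of infinite intensity the count is infinite almost
  surely, and its factor is zero on both sides unless its coefficient is zero.
\<close>
lemma (in prob_space) poisson_point_process_exp_neg_step:
  fixes n :: nat
  assumes ppp: "poisson_point_process M \<mu> \<xi>"
    and B: "\<And>j. j < n \<Longrightarrow> B j \<in> sets \<mu>" "disjoint_family_on B {..<n}"
  shows "(\<integral>\<^sup>+\<omega>. exp_neg (\<Sum>j<n. c j * \<xi> (B j) \<omega>) \<partial>M)
    = exp_neg (\<Sum>j<n. (1 - exp_neg (c j)) * emeasure \<mu> (B j))"
proof -
  have one: "(\<integral>\<^sup>+\<omega>. exp_neg (c j * \<xi> (B j) \<omega>) \<partial>M) = exp_neg ((1 - exp_neg (c j)) * emeasure \<mu> (B j))"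
    if j: "j < n" for j
  proof (cases "emeasure \<mu> (B j) = \<infinity>")
    case True
    then have *: "AE \<omega> in M. \<xi> (B j) \<omega> = \<top>" using ppp B(1)[OF j] by (auto simp: poisson_point_process_def)
    show ?thesis
    proof (cases "c j = 0")
      case False
      then have "1 - exp_neg (c j) \<noteq> 0"
        by (cases "c j") (auto simp: exp_neg_ennreal dest!: ennreal_minus_eq_0)
      then have "exp_neg ((1 - exp_neg (c j)) * emeasure \<mu> (B j)) = 0"
        by (simp add: True ennreal_mult_top)
      moreover have "(\<integral>\<^sup>+\<omega>. exp_neg (c j * \<xi> (B j) \<omega>) \<partial>M) = (\<integral>\<^sup>+\<omega>. 0 \<partial>M)"
        using * by (intro nn_integral_cong_AE, eventually_elim) (simp add: ennreal_mult_top False)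
      ultimately show ?thesis by simp
    qed (simp add: emeasure_space_1)
  next
    case False
    then have "emeasure \<mu> (B j) = ennreal (measure \<mu> (B j))"
      by (simp add: emeasure_eq_ennreal_measure)
    moreover have "(\<integral>\<^sup>+\<omega>. exp_neg (c j * \<xi> (B j) \<omega>) \<partial>M)
        = exp_neg (ennreal (measure \<mu> (B j)) * (1 - exp_neg (c j)))"
      using ppp B(1)[OF j] False
      by (intro poisson_exp_neg) (auto simp: poisson_point_process_def less_top)
    ultimately show ?thesis by (simp add: mult.commute)
  qed
  have "indep_vars (\<lambda>_. borel) (\<lambda>j. \<xi> (B j)) {..<n}"
    using ppp B unfolding poisson_point_process_def by blast
  then have "indep_vars (\<lambda>_. borel) (\<lambda>j \<omega>. exp_neg (c j * \<xi> (B j) \<omega>)) {..<n}"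
    by (rule indep_vars_compose2) auto
  from indep_vars_nn_integral[OF _ this] show ?thesis
    by (simp add: exp_neg_sum one)
qed

text \<open>
  A simple function is a step function over its level sets, on which the counts are independent.
  Increasing simple approximations $g_k$ of $f$ then give the general case, by dominated convergence
  on the left and monotone convergence on the right.
\<close>
lemma (in prob_space) poisson_point_process_exp_neg:
  assumes ppp: "poisson_point_process M \<mu> (dirac_sum A)"
    and [measurable]: "\<And>i. A i \<in> M \<rightarrow>\<^sub>M \<mu>" "f \<in> borel_measurable \<mu>"
  shows "(\<integral>\<^sup>+\<omega>. exp_neg (\<Sum>i. f (A i \<omega>)) \<partial>M) = exp_neg (\<integral>\<^sup>+a. 1 - exp_neg (f a) \<partial>\<mu>)"
proof -
  have simple: "(\<integral>\<^sup>+\<omega>. exp_neg (\<Sum>i. g (A i \<omega>)) \<partial>M) = exp_neg (\<integral>\<^sup>+a. 1 - exp_neg (g a) \<partial>\<mu>)"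
    if g: "simple_function \<mu> g" for g :: "_ \<Rightarrow> ennreal"
  proof -
    define n where "n = card (g ` space \<mu>)"
    obtain c where c: "bij_betw c {..<n} (g ` space \<mu>)"
      using ex_bij_betw_nat_finite[of "g ` space \<mu>"] simple_functionD(1)[OF g]
      by (auto simp: n_def atLeast0LessThan)
    define B where "B j = g -` {c j} \<inter> space \<mu>" for j
    have B: "B j \<in> sets \<mu>" for j
      unfolding B_def by (rule simple_functionD(2)[OF g])
    have disj: "disjoint_family_on B {..<n}"
      using c by (auto simp: disjoint_family_on_def B_def bij_betw_def inj_on_def)
    have repr: "h (g a) = (\<Sum>j<n. h (c j) * indicator (B j) a)"
      if "a \<in> space \<mu>" for h :: "ennreal \<Rightarrow> ennreal" and a
    proof -
      obtain j where j: "j < n" "g a = c j"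
        using c \<open>a \<in> space \<mu>\<close> by (auto simp: bij_betw_def set_eq_iff image_iff)
      have "(\<Sum>i<n. h (c i) * indicator (B i) a) = (\<Sum>i<n. if i = j then h (c j) else 0)"
        using j c that by (intro sum.cong) (auto simp: B_def indicator_def bij_betw_def inj_on_def)
      then show ?thesis using j by simp
    qed
    have "(\<Sum>i. g (A i \<omega>)) = (\<Sum>j<n. c j * dirac_sum A (B j) \<omega>)" if "\<omega> \<in> space M" for \<omega>
    proof -
      have "A i \<omega> \<in> space \<mu>" for i using that by (rule measurable_space[OF assms(2)])
      then have "(\<Sum>i. g (A i \<omega>)) = (\<Sum>i. \<Sum>j<n. c j * indicator (B j) (A i \<omega>))"
        by (simp add: repr[of _ "\<lambda>x. x"])
      also have "\<dots> = (\<Sum>j<n. \<Sum>i. c j * indicator (B j) (A i \<omega>))"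
        by (rule suminf_sum) simp
      finally show ?thesis by (simp add: dirac_sum_def)
    qed
    then have "(\<integral>\<^sup>+\<omega>. exp_neg (\<Sum>i. g (A i \<omega>)) \<partial>M) = (\<integral>\<^sup>+\<omega>. exp_neg (\<Sum>j<n. c j * dirac_sum A (B j) \<omega>) \<partial>M)"
      by (intro nn_integral_cong) simp
    also have "\<dots> = exp_neg (\<Sum>j<n. (1 - exp_neg (c j)) * emeasure \<mu> (B j))"
      using ppp B disj by (rule poisson_point_process_exp_neg_step)
    also have "(\<Sum>j<n. (1 - exp_neg (c j)) * emeasure \<mu> (B j)) = (\<integral>\<^sup>+a. 1 - exp_neg (g a) \<partial>\<mu>)"
    proof -
      have "(\<integral>\<^sup>+a. 1 - exp_neg (g a) \<partial>\<mu>) = (\<integral>\<^sup>+a. (\<Sum>j<n. (1 - exp_neg (c j)) * indicator (B j) a) \<partial>\<mu>)"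
        by (intro nn_integral_cong) (rule repr)
      then show ?thesis
        using B by (simp only:) (subst nn_integral_sum, auto simp: nn_integral_cmult_indicator)
    qed
    finally show ?thesis .
  qed
  obtain g where g: "\<And>k. simple_function \<mu> (g k)" "incseq g" "\<And>a. (SUP k. g k a) = f a"
    using borel_measurable_implies_simple_function_sequence'[OF assms(3)] by metis
  note [measurable] = borel_measurable_simple_function[OF g(1)]
  have inc: "incseq (\<lambda>k. g k a)" for a
    using g(2) by (auto simp: incseq_def le_fun_def)
  have "(\<lambda>k. \<integral>\<^sup>+\<omega>. exp_neg (\<Sum>i. g k (A i \<omega>)) \<partial>M) \<longlonglongrightarrow> (\<integral>\<^sup>+\<omega>. exp_neg (\<Sum>i. f (A i \<omega>)) \<partial>M)"
  proof (intro nn_integral_exp_neg_tendsto AE_I2)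
    fix \<omega>
    have "incseq (\<lambda>k. \<Sum>i. g k (A i \<omega>))"
      using inc by (auto simp: incseq_def intro!: suminf_le)
    then have "(\<lambda>k. \<Sum>i. g k (A i \<omega>)) \<longlonglongrightarrow> (SUP k. \<Sum>i. g k (A i \<omega>))"
      by (rule LIMSEQ_SUP)
    also have "(SUP k. \<Sum>i. g k (A i \<omega>)) = (\<Sum>i. f (A i \<omega>))"
      by (subst ennreal_suminf_SUP_eq[symmetric]) (auto simp: inc g(3))
    finally show "(\<lambda>k. \<Sum>i. g k (A i \<omega>)) \<longlonglongrightarrow> (\<Sum>i. f (A i \<omega>))" .
  qed (auto simp: finite_measure_axioms)
  moreover have "(\<lambda>k. exp_neg (\<integral>\<^sup>+a. 1 - exp_neg (g k a) \<partial>\<mu>)) \<longlonglongrightarrow> exp_neg (\<integral>\<^sup>+a. 1 - exp_neg (f a) \<partial>\<mu>)"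
  proof (rule tendsto_exp_neg)
    have lim: "(\<lambda>k. 1 - exp_neg (g k a)) \<longlonglongrightarrow> 1 - exp_neg (f a)" for a
      using LIMSEQ_SUP[OF inc[of a]] unfolding g(3)
      by (intro tendsto_diff_ennreal tendsto_const tendsto_exp_neg) simp_all
    have inc': "incseq (\<lambda>k. 1 - exp_neg (g k a))" for a
      using inc[of a] by (auto simp: incseq_def intro!: ennreal_mono_minus exp_neg_antimono)
    have "(SUP k. 1 - exp_neg (g k a)) = 1 - exp_neg (f a)" for a
      by (rule LIMSEQ_unique[OF LIMSEQ_SUP[OF inc'] lim])
    then have "(\<integral>\<^sup>+a. 1 - exp_neg (f a) \<partial>\<mu>) = (SUP k. \<integral>\<^sup>+a. 1 - exp_neg (g k a) \<partial>\<mu>)"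
      using inc' by (subst nn_integral_monotone_convergence_SUP[symmetric]) (auto simp: incseq_def le_fun_def)
    moreover have "incseq (\<lambda>k. \<integral>\<^sup>+a. 1 - exp_neg (g k a) \<partial>\<mu>)"
      using inc' by (auto simp: incseq_def intro!: nn_integral_mono)
    ultimately show "(\<lambda>k. \<integral>\<^sup>+a. 1 - exp_neg (g k a) \<partial>\<mu>) \<longlonglongrightarrow> (\<integral>\<^sup>+a. 1 - exp_neg (f a) \<partial>\<mu>)"
      using LIMSEQ_SUP by metis
  qed
  ultimately show ?thesis
    using LIMSEQ_unique by (simp add: simple[OF g(1)])
qed

section \<open>Adding independent marks\<close>

lemma (in prob_space) measurable_from_generated:
  assumes "sigma_sets (space M) E \<subseteq> events" and X: "X \<in> sigma (space M) E \<rightarrow>\<^sub>M M1"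
  shows "X \<in> M \<rightarrow>\<^sub>M M1"
    and "A \<in> sets M1 \<Longrightarrow> X -` A \<inter> space M \<in> sigma_sets (space M) E"
proof -
  have E: "E \<subseteq> Pow (space M)"
    using assms(1) sets.space_closed by (blast intro: sigma_sets.Basic)
  then show pre: "A \<in> sets M1 \<Longrightarrow> X -` A \<inter> space M \<in> sigma_sets (space M) E" for A
    using measurable_sets[OF X, of A] by (simp add: space_measure_of sets_measure_of)
  show "X \<in> M \<rightarrow>\<^sub>M M1"
    using measurable_space[OF X] pre assms(1) E by (intro measurableI) (auto simp: space_measure_of)
qed

text \<open>
  Fubini's theorem for random elements of possibly different types which are measurable with respect
  to two independent $\sigma$-algebras: their joint law is the product of the marginal laws.
\<close>
lemma (in prob_space) indep_set_nn_integral: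
  assumes indep: "indep_set (sigma_sets (space M) E1) (sigma_sets (space M) E2)"
    and X: "X \<in> sigma (space M) E1 \<rightarrow>\<^sub>M M1" and Y: "Y \<in> sigma (space M) E2 \<rightarrow>\<^sub>M M2"
    and h[measurable]: "h \<in> borel_measurable (M1 \<Otimes>\<^sub>M M2)"
  shows "(\<integral>\<^sup>+\<omega>. h (X \<omega>, Y \<omega>) \<partial>M) = (\<integral>\<^sup>+\<omega>'. \<integral>\<^sup>+\<omega>. h (X \<omega>', Y \<omega>) \<partial>M \<partial>M)"
proof -
  have sub: "sigma_sets (space M) E1 \<subseteq> events" "sigma_sets (space M) E2 \<subseteq> events"
    and ind: "\<And>a b. a \<in> sigma_sets (space M) E1 \<Longrightarrow> b \<in> sigma_sets (space M) E2
      \<Longrightarrow> prob (a \<inter> b) = prob a * prob b"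
    using indep by (auto simp: indep_sets2_eq)
  note X' = measurable_from_generated[OF sub(1) X] and Y' = measurable_from_generated[OF sub(2) Y]
  note [measurable] = X'(1) Y'(1)
  interpret X: prob_space "distr M M1 X" by (rule prob_space_distr) simp
  interpret Y: prob_space "distr M M2 Y" by (rule prob_space_distr) simp
  have law: "distr M M1 X \<Otimes>\<^sub>M distr M M2 Y = distr M (M1 \<Otimes>\<^sub>M M2) (\<lambda>\<omega>. (X \<omega>, Y \<omega>))"
  proof (rule pair_measure_eqI)
    fix A B assume "A \<in> sets (distr M M1 X)" "B \<in> sets (distr M M2 Y)"
    then have [measurable]: "A \<in> sets M1" "B \<in> sets M2" by auto
    have "emeasure (distr M (M1 \<Otimes>\<^sub>M M2) (\<lambda>\<omega>. (X \<omega>, Y \<omega>))) (A \<times> B)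
        = emeasure M ((X -` A \<inter> space M) \<inter> (Y -` B \<inter> space M))"
      by (subst emeasure_distr) (auto intro!: arg_cong[where f="emeasure M"])
    also have "\<dots> = emeasure M (X -` A \<inter> space M) * emeasure M (Y -` B \<inter> space M)"
      unfolding emeasure_eq_measure using ind[OF X'(2) Y'(2)] by (simp add: ennreal_mult')
    finally show "emeasure (distr M M1 X) A * emeasure (distr M M2 Y) B
        = emeasure (distr M (M1 \<Otimes>\<^sub>M M2) (\<lambda>\<omega>. (X \<omega>, Y \<omega>))) (A \<times> B)"
      by (simp add: emeasure_distr)
  qed (simp_all add: X.sigma_finite_measure_axioms Y.sigma_finite_measure_axioms)
  have "(\<integral>\<^sup>+\<omega>. h (X \<omega>, Y \<omega>) \<partial>M) = (\<integral>\<^sup>+z. h z \<partial>(distr M M1 X \<Otimes>\<^sub>M distr M M2 Y))"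
    unfolding law by (subst nn_integral_distr) auto
  also have "\<dots> = (\<integral>\<^sup>+x. \<integral>\<^sup>+y. h (x, y) \<partial>distr M M2 Y \<partial>distr M M1 X)"
    by (subst Y.nn_integral_fst) auto
  also have "\<dots> = (\<integral>\<^sup>+\<omega>'. \<integral>\<^sup>+y. h (X \<omega>', y) \<partial>distr M M2 Y \<partial>M)"
    by (subst nn_integral_distr) (auto intro!: Y.borel_measurable_nn_integral)
  also have "\<dots> = (\<integral>\<^sup>+\<omega>'. \<integral>\<^sup>+\<omega>. h (X \<omega>', Y \<omega>) \<partial>M \<partial>M)"
  proof (rule nn_integral_cong)
    fix \<omega>' assume "\<omega>' \<in> space M"
    then have [simp]: "X \<omega>' \<in> space M1" by (rule measurable_space[OF X'(1)])
    show "(\<integral>\<^sup>+y. h (X \<omega>', y) \<partial>distr M M2 Y) = (\<integral>\<^sup>+\<omega>. h (X \<omega>', Y \<omega>) \<partial>M)"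
      by (subst nn_integral_distr) auto
  qed
  finally show ?thesis .
qed

text \<open>
  For fixed points $a_i$ the marks are independent, so that integrating them out replaces $F(a_i, W_i)$ by
  $f(a_i)$ with $e^{-f(a)} = E(e^{-F(a, W)})$. The Laplace functional of the unmarked process at $f$
  then has the exponent $\int E(1 - e^{-F(a, W)})\, d\mu(a)$, in which the two integrals may be
  exchanged.
\<close>
lemma (in prob_space) marked_poisson_exp_neg:
  fixes W :: "nat \<Rightarrow> 'a \<Rightarrow> 'm" and A :: "nat \<Rightarrow> 'a \<Rightarrow> 'b"
  assumes ppp: "poisson_point_process M \<mu> (dirac_sum A)" and \<mu>: "sigma_finite_measure \<mu>"
    and W: "indep_vars (\<lambda>_. K) W UNIV" and law: "\<And>i. distr M K (W i) = Q"
    and indep: "indep_set (sigma_sets (space M) E1) (sigma_sets (space M) E2)"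
    and A_E1: "\<And>i. A i \<in> sigma (space M) E1 \<rightarrow>\<^sub>M \<mu>" and W_E2: "\<And>i. W i \<in> sigma (space M) E2 \<rightarrow>\<^sub>M K"
    and F [measurable]: "(\<lambda>(a, w). F a w) \<in> borel_measurable (\<mu> \<Otimes>\<^sub>M K)"
  shows "(\<integral>\<^sup>+\<omega>. exp_neg (\<Sum>i. F (A i \<omega>) (W i \<omega>)) \<partial>M)
    = exp_neg (\<integral>\<^sup>+w. \<integral>\<^sup>+a. 1 - exp_neg (F a w) \<partial>\<mu> \<partial>Q)"
proof -
  interpret \<mu>: sigma_finite_measure \<mu> by fact
  have [measurable]: "W i \<in> M \<rightarrow>\<^sub>M K" for i using W by (auto simp: indep_vars_def)
  have [measurable]: "A i \<in> M \<rightarrow>\<^sub>M \<mu>" for i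
    using indep measurable_from_generated(1)[OF _ A_E1] by (auto simp: indep_sets2_eq)
  have Q: "prob_space Q" using law[of 0] by (metis prob_space_distr \<open>\<And>i. W i \<in> M \<rightarrow>\<^sub>M K\<close>)
  interpret Q: prob_space Q by fact
  have [measurable_cong, simp]: "sets Q = sets K" using law[of 0] by (metis sets_distr)
  interpret pair_sigma_finite \<mu> Q ..
  define f where "f a = neg_ln (\<integral>\<^sup>+w. exp_neg (F a w) \<partial>Q)" for a
  have [measurable]: "f \<in> borel_measurable \<mu>" unfolding f_def by measurable
  have "(\<integral>\<^sup>+\<omega>. exp_neg (\<Sum>i. F (A i \<omega>) (W i \<omega>)) \<partial>M)
      = (\<integral>\<^sup>+\<omega>'. \<integral>\<^sup>+\<omega>. exp_neg (\<Sum>i. F (A i \<omega>') (W i \<omega>)) \<partial>M \<partial>M)"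
  proof -
    have "(\<lambda>\<omega> i. A i \<omega>) \<in> sigma (space M) E1 \<rightarrow>\<^sub>M PiM UNIV (\<lambda>_. \<mu>)"
      "(\<lambda>\<omega> i. W i \<omega>) \<in> sigma (space M) E2 \<rightarrow>\<^sub>M PiM UNIV (\<lambda>_. K)"
      using A_E1 W_E2 by (auto intro!: measurable_PiM_single' dest: measurable_space)
    from indep_set_nn_integral[OF indep this, of "\<lambda>(a, w). exp_neg (\<Sum>i. F (a i) (w i))"]
    show ?thesis by simp
  qed
  also have "\<dots> = (\<integral>\<^sup>+\<omega>'. exp_neg (\<Sum>i. f (A i \<omega>')) \<partial>M)"
  proof (rule nn_integral_cong)
    fix \<omega>' assume "\<omega>' \<in> space M"
    then have A': "A i \<omega>' \<in> space \<mu>" for i by (rule measurable_space[rotated]) simp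
    then have F': "F (A i \<omega>') \<in> borel_measurable K" for i
      using measurable_Pair2[OF F] by simp
    then have f: "f (A i \<omega>') = neg_ln (\<integral>\<^sup>+\<omega>. exp_neg (F (A i \<omega>') (W i \<omega>)) \<partial>M)" for i
      unfolding f_def by (subst law[of i, symmetric], subst nn_integral_distr) auto
    have "indep_vars (\<lambda>_. borel) (\<lambda>i \<omega>. F (A i \<omega>') (W i \<omega>)) UNIV"
      using F' by (intro indep_vars_compose2[OF W]) auto
    from nn_integral_exp_neg_suminf_indep[OF this]
    show "(\<integral>\<^sup>+\<omega>. exp_neg (\<Sum>i. F (A i \<omega>') (W i \<omega>)) \<partial>M) = exp_neg (\<Sum>i. f (A i \<omega>'))"
      by (simp add: f)
  qed
  also have "\<dots> = exp_neg (\<integral>\<^sup>+a. 1 - exp_neg (f a) \<partial>\<mu>)"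
    by (rule poisson_point_process_exp_neg[OF ppp]) auto
  also have "(\<integral>\<^sup>+a. 1 - exp_neg (f a) \<partial>\<mu>) = (\<integral>\<^sup>+a. \<integral>\<^sup>+w. 1 - exp_neg (F a w) \<partial>Q \<partial>\<mu>)"
  proof (rule nn_integral_cong)
    fix a assume a [simp]: "a \<in> space \<mu>"
    have "(\<integral>\<^sup>+w. 1 - exp_neg (F a w) \<partial>Q) = (\<integral>\<^sup>+w. 1 \<partial>Q) - (\<integral>\<^sup>+w. exp_neg (F a w) \<partial>Q)"
      using Q.nn_integral_exp_neg_le_1[of "F a"]
      by (intro nn_integral_diff) (auto simp: exp_neg_le_1 top_unique)
    then show "1 - exp_neg (f a) = (\<integral>\<^sup>+w. 1 - exp_neg (F a w) \<partial>Q)"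
      by (simp add: f_def exp_neg_neg_ln Q.nn_integral_exp_neg_le_1 Q.emeasure_space_1)
  qed
  also have "\<dots> = (\<integral>\<^sup>+w. \<integral>\<^sup>+a. 1 - exp_neg (F a w) \<partial>\<mu> \<partial>Q)"
    using Fubini'[of "\<lambda>a w. 1 - exp_neg (F a w)"] by simp
  finally show ?thesis .
qed

section \<open>The Frechet distribution function and the p-norm\<close>

text \<open>
  The exponent $\varphi_p(z) = - \ln \Phi_p(1 / z)$, that is $z^p$ for finite $p$; for $p = \infty$ it
  jumps from $0$ to $\infty$ above $z = 1$.
\<close>
definition frechet_exponent :: "ereal \<Rightarrow> real \<Rightarrow> ennreal" where
  "frechet_exponent p z =
     (if p = \<infinity> then (if z \<le> 1 then 0 else \<top>) else ennreal (z powr real_of_ereal p))"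

lemma measurable_frechet_exponent [measurable]: "frechet_exponent p \<in> borel_measurable borel"
  unfolding frechet_exponent_def by measurable

lemma real_of_ereal_gt_1: "1 < p \<Longrightarrow> p \<noteq> \<infinity> \<Longrightarrow> 1 < real_of_ereal p"
  by (cases p) auto

lemma exp_neg_frechet_exponent:
  assumes "1 < p" "0 \<le> z" "0 < y"
  shows "exp_neg (frechet_exponent p (z / y)) = (if z = 0 then 1 else ennreal (frechet_cdf p (y / z)))"
proof (cases "p = \<infinity>")
  case True
  then show ?thesis using assms
    by (auto simp: frechet_exponent_def frechet_cdf_def field_simps)
next
  case False
  then show ?thesis using assms real_of_ereal_gt_1[OF assms(1) False]
    by (auto simp: frechet_exponent_def frechet_cdf_def exp_neg_ennreal powr_minus powr_divide)
qed

text \<open>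
  The identity $\prod_i \Phi_p(y / z_i) = \Phi_p(y / \|z\|_p)$ behind the theorem, in terms of
  exponents. Finiteness at some scale \<open>y0\<close> means that the norm is finite: \<^const>\<open>lp_norm\<close> sends an
  infinite norm to $0$, for which the identity would be false.
\<close>
lemma suminf_frechet_exponent:
  assumes p: "1 < p" and x: "\<And>i. 0 \<le> x i" and y: "0 < y" "0 < y0"
    and fin: "(\<Sum>i. frechet_exponent p (x i / y0)) < \<top>"
  shows "(\<Sum>i. frechet_exponent p (x i / y)) = frechet_exponent p (lp_norm p x / y)"
proof (cases "p = \<infinity>")
  case True
  have le: "x i \<le> y0" for i
  proof (rule ccontr)
    assume "\<not> x i \<le> y0"
    then have "\<top> = frechet_exponent p (x i / y0)" using y True by (simp add: frechet_exponent_def field_simps)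
    also have "\<dots> = (\<Sum>j\<in>{i}. frechet_exponent p (x j / y0))" by simp
    also have "\<dots> \<le> (\<Sum>i. frechet_exponent p (x i / y0))" by (rule sum_le_suminf) auto
    finally show False using fin by (simp add: top_unique)
  qed
  \<comment> \<open>The supremum is finite, hence it is not lost in the passage to the reals.\<close>
  then have bdd: "(SUP i. ennreal (x i)) \<le> ennreal y0" by (intro SUP_least ennreal_leI)
  then have "(SUP i. ennreal (x i)) = ennreal (lp_norm p x)"
    using True by (simp add: lp_norm_def less_top[symmetric] top_unique) (metis ennreal_enn2real ennreal_less_top order_le_less_trans)
  moreover have "(SUP i. ennreal (x i)) \<le> ennreal y \<longleftrightarrow> (\<forall>i. x i \<le> y)"
    using y by (simp add: SUP_le_iff ennreal_le_iff)
  ultimately have iff: "lp_norm p x \<le> y \<longleftrightarrow> (\<forall>i. x i \<le> y)" using y by (simp add: ennreal_le_iff)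
  show ?thesis
  proof (cases "\<forall>i. x i \<le> y")
    case False
    then obtain i where "\<not> x i \<le> y" by auto
    then have "\<top> = (\<Sum>j\<in>{i}. frechet_exponent p (x j / y))" using y True by (simp add: frechet_exponent_def field_simps)
    also have "\<dots> \<le> (\<Sum>i. frechet_exponent p (x i / y))" by (rule sum_le_suminf) auto
    finally show ?thesis using False iff y True by (simp add: frechet_exponent_def field_simps top_unique)
  qed (use iff y True in \<open>simp add: frechet_exponent_def field_simps\<close>)
next
  case False
  define r where "r = real_of_ereal p"
  have r: "1 < r" using real_of_ereal_gt_1[OF p False] by (simp add: r_def)
  define N where "N = (\<Sum>i. ennreal (x i powr r))"
  have sc: "(\<Sum>i. frechet_exponent p (x i / z)) = ennreal (1 / z powr r) * N" if "0 < z" for z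
  proof -
    have "(\<Sum>i. frechet_exponent p (x i / z)) = (\<Sum>i. ennreal (1 / z powr r) * ennreal (x i powr r))"
      using x that False by (simp add: frechet_exponent_def r_def[symmetric] powr_divide ennreal_mult'[symmetric])
    then show ?thesis by (simp add: N_def)
  qed
  have "N < \<top>"
    using fin y unfolding sc[OF y(2)] by (auto simp: less_top[symmetric] ennreal_mult_eq_top_iff)
  then obtain n where n: "N = ennreal n" "0 \<le> n" by (cases N) auto
  have "lp_norm p x = n powr (1 / r)"
    using n False by (simp add: lp_norm_def N_def[symmetric] r_def[symmetric])
  then have "frechet_exponent p (lp_norm p x / y) = ennreal (1 / y powr r * n)"
    using False y n r by (cases "n = 0") (simp_all add: frechet_exponent_def r_def[symmetric] powr_divide powr_powr)
  then show ?thesis unfolding sc[OF y(1)] n(1) using n y by (simp add: ennreal_mult'[symmetric])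
qed

section \<open>The intensity\<close>

lemma nn_integral_frechet_intensity:
  assumes [measurable]: "f \<in> borel_measurable borel"
  shows "(\<integral>\<^sup>+a. f a \<partial>frechet_intensity) = (\<integral>\<^sup>+a. f a * (indicator {0<..} a * ennreal (1 / a\<^sup>2)) \<partial>lborel)"
  unfolding frechet_intensity_def
  by (subst nn_integral_density)
     (auto simp: nn_integral_restrict_space mult_ac intro!: measurable_restrict_space1)

lemma sets_frechet_intensity: "sets frechet_intensity = sets (restrict_space borel {0<..})"
  unfolding frechet_intensity_def by (simp cong: sets_restrict_space_cong)

lemma sigma_finite_frechet_intensity: "sigma_finite_measure frechet_intensity"
proof -
  interpret sigma_finite_measure "restrict_space lborel {0::real<..}"
    by (rule sigma_finite_measure_restrict_space) (auto intro: lborel.sigma_finite_measure_axioms)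
  show ?thesis unfolding frechet_intensity_def
    by (subst sigma_finite_iff_density_finite') (auto intro!: measurable_restrict_space1)
qed

text \<open>
  The source of max-stability: the measure $a^{-2} da$ is homogeneous of degree $-1$ under
  dilations.
\<close>
lemma nn_integral_frechet_intensity_scale:
  assumes [measurable]: "f \<in> borel_measurable borel" and c: "0 < c"
  shows "(\<integral>\<^sup>+a. f (c * a) \<partial>frechet_intensity) = ennreal c * (\<integral>\<^sup>+a. f a \<partial>frechet_intensity)"
proof -
  have "(\<integral>\<^sup>+a. f a \<partial>frechet_intensity)
      = ennreal c * (\<integral>\<^sup>+a. f (c * a) * (indicator {0<..} (c * a) * ennreal (1 / (c * a)\<^sup>2)) \<partial>lborel)"
    unfolding nn_integral_frechet_intensity[OF assms(1)]
    using c by (subst nn_integral_real_affine[where c=c and t=0]) auto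
  also have "(\<integral>\<^sup>+a. f (c * a) * (indicator {0<..} (c * a) * ennreal (1 / (c * a)\<^sup>2)) \<partial>lborel)
      = (\<integral>\<^sup>+a. ennreal (1 / c\<^sup>2) * (f (c * a) * (indicator {0<..} a * ennreal (1 / a\<^sup>2))) \<partial>lborel)"
    using c by (intro nn_integral_cong)
      (auto simp: indicator_def power_mult_distrib zero_less_mult_iff mult_ac ennreal_mult'[symmetric])
  also have "\<dots> = ennreal (1 / c\<^sup>2) * (\<integral>\<^sup>+a. f (c * a) \<partial>frechet_intensity)"
    by (simp add: nn_integral_frechet_intensity nn_integral_cmult)
  finally have "ennreal c * (\<integral>\<^sup>+a. f a \<partial>frechet_intensity)
      = (ennreal c * (ennreal c * ennreal (1 / c\<^sup>2))) * (\<integral>\<^sup>+a. f (c * a) \<partial>frechet_intensity)"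
    by (simp only: mult.assoc)
  also have "ennreal c * (ennreal c * ennreal (1 / c\<^sup>2)) = 1"
    using c by (simp add: power2_eq_square flip: ennreal_mult)
  finally show ?thesis by simp
qed

lemma frechet_intensity_tail:
  assumes c: "0 < c"
  shows "(\<integral>\<^sup>+a. indicator {c..} a * ennreal (1 / a\<^sup>2) \<partial>lborel) = ennreal (1 / c)"
proof -
  have "(\<integral>\<^sup>+a. ennreal (1 / a\<^sup>2) * indicator {c..} a \<partial>lborel) = 0 - (- (1 / c))"
  proof (rule nn_integral_FTC_atLeast[where F="\<lambda>a. - (1 / a)"])
    show "((\<lambda>a::real. - (1 / a)) \<longlongrightarrow> 0) at_top"
      using tendsto_minus[OF tendsto_divide_0[OF tendsto_const filterlim_at_top_imp_at_infinity[OF filterlim_ident]]]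
      by simp
  qed (use c in \<open>auto intro!: derivative_eq_intros simp: power2_eq_square\<close>)
  then show ?thesis by (simp add: mult.commute)
qed

text \<open>
  For finite $p$, writing $1 - e^{-a^p} = \int_0^{a^p} e^{-u} du$ and exchanging the integrals leaves
  $\int_0^\infty e^{-u} \bigl(\int_{u^{1/p}}^\infty a^{-2} da\bigr) du = \int_0^\infty u^{-1/p} e^{-u} du$,
  which is Euler's integral. It converges because $p > 1$. For $p = \infty$ the integral is the mass of
  $[1, \infty)$, which is $1 = \Gamma(1)$.
\<close>
lemma nn_integral_frechet_exponent:
  assumes p: "1 < p"
  shows "(\<integral>\<^sup>+a. 1 - exp_neg (frechet_exponent p a) \<partial>frechet_intensity)
    = ennreal (Gamma (1 - real_of_ereal (inverse p)))"
proof (cases "p = \<infinity>")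
  case True
  have "(\<integral>\<^sup>+a. 1 - exp_neg (frechet_exponent p a) \<partial>frechet_intensity)
      = (\<integral>\<^sup>+a. indicator {1..} a * ennreal (1 / a\<^sup>2) \<partial>lborel)"
    by (subst nn_integral_frechet_intensity, measurable, intro nn_integral_cong_AE)
       (use AE_lborel_singleton[of "1::real"] in \<open>eventually_elim, auto simp: frechet_exponent_def True indicator_def\<close>)
  then show ?thesis using frechet_intensity_tail[of 1] True by simp
next
  case False
  define r where "r = real_of_ereal p"
  have r: "1 < r" using real_of_ereal_gt_1[OF p False] by (simp add: r_def)
  have inv: "real_of_ereal (inverse p) = 1 / r"
    using p False by (cases p) (auto simp: r_def field_simps)
  have FTC: "1 - exp_neg (frechet_exponent p a) = (\<integral>\<^sup>+u. ennreal (exp (- u)) * indicator {0..a powr r} u \<partial>lborel)" for a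
  proof -
    have "(\<integral>\<^sup>+u. ennreal (exp (- u)) * indicator {0..a powr r} u \<partial>lborel)
        = (- exp (- (a powr r))) - (- exp (- 0))"
      by (rule nn_integral_FTC_Icc) (auto intro!: derivative_eq_intros)
    then show ?thesis using False
      by (simp add: frechet_exponent_def r_def[symmetric] exp_neg_ennreal ennreal_minus flip: ennreal_1)
  qed
  have "(\<integral>\<^sup>+a. 1 - exp_neg (frechet_exponent p a) \<partial>frechet_intensity)
      = (\<integral>\<^sup>+a. (\<integral>\<^sup>+u. ennreal (exp (- u)) * indicator {0..a powr r} u * (indicator {0<..} a * ennreal (1 / a\<^sup>2)) \<partial>lborel) \<partial>lborel)"
    by (simp add: nn_integral_frechet_intensity FTC[symmetric] nn_integral_multc)
  also have "\<dots> = (\<integral>\<^sup>+u. (\<integral>\<^sup>+a. ennreal (exp (- u)) * indicator {0..a powr r} u * (indicator {0<..} a * ennreal (1 / a\<^sup>2)) \<partial>lborel) \<partial>lborel)"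
    by (rule lborel_pair.Fubini') (simp add: indicator_def, measurable)
  also have "\<dots> = (\<integral>\<^sup>+u. ennreal (indicator {0..} u * u powr ((1 - 1 / r) - 1) / exp u) \<partial>lborel)"
  proof (intro nn_integral_cong_AE, use AE_lborel_singleton[of "0::real"] in eventually_elim)
    case (elim u)
    show ?case
    proof (cases "0 < u")
      case True
      have iff: "u \<le> a powr r \<longleftrightarrow> u powr (1 / r) \<le> a" if "0 < a" for a
        using that True r powr_mono2[of "1 / r" u "a powr r"] powr_mono2[of r "u powr (1 / r)" a]
        by (auto simp: powr_powr)
      have pos: "0 < u powr (1 / r)" using True by simp
      have "(\<integral>\<^sup>+a. ennreal (exp (- u)) * indicator {0..a powr r} u * (indicator {0<..} a * ennreal (1 / a\<^sup>2)) \<partial>lborel)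
         = (\<integral>\<^sup>+a. ennreal (exp (- u)) * (indicator {u powr (1 / r)..} a * ennreal (1 / a\<^sup>2)) \<partial>lborel)"
      proof (rule nn_integral_cong)
        fix a :: real
        have "0 < a \<and> u \<le> a powr r \<longleftrightarrow> u powr (1 / r) \<le> a"
          using iff[of a] order.strict_trans2[OF pos, of a] by blast
        then show "ennreal (exp (- u)) * indicator {0..a powr r} u * (indicator {0<..} a * ennreal (1 / a\<^sup>2))
            = ennreal (exp (- u)) * (indicator {u powr (1 / r)..} a * ennreal (1 / a\<^sup>2))"
          using True by (auto simp: indicator_def)
      qed
      also have "\<dots> = ennreal (exp (- u)) * ennreal (1 / u powr (1 / r))"
        by (subst nn_integral_cmult, measurable) (simp only: frechet_intensity_tail[OF pos])
      finally show ?thesis using True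
        by (simp add: ennreal_mult'[symmetric] exp_minus powr_minus field_simps)
    qed (use elim in simp)
  qed
  also have "\<dots> = ennreal (Gamma (1 - 1 / r))"
    using r by (intro Gamma_conv_nn_integral_real[symmetric]) simp
  finally show ?thesis unfolding inv .
qed

section \<open>Events and laws of processes\<close>

lemma process_events_subset: "process_events M S X \<subseteq> Pow (space M)"
  by (auto simp: process_events_def)

lemma Int_stable_process_events: "Int_stable (process_events M S X)"
proof (rule Int_stableI)
  fix a b assume "a \<in> process_events M S X" "b \<in> process_events M S X"
  then obtain A B where "A \<in> sets (PiM S (\<lambda>_. borel))" "B \<in> sets (PiM S (\<lambda>_. borel))"
    "a = (\<lambda>\<omega>. \<lambda>s\<in>S. X s \<omega>) -` A \<inter> space M" "b = (\<lambda>\<omega>. \<lambda>s\<in>S. X s \<omega>) -` B \<inter> space M"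
    by (auto simp: process_events_def)
  then show "a \<inter> b \<in> process_events M S X"
    unfolding process_events_def by (intro CollectI exI[of _ "A \<inter> B"]) auto
qed

lemma measurable_process_events:
  assumes s: "s \<in> S" and E: "process_events M S X \<subseteq> E" "E \<subseteq> Pow (space M)"
  shows "X s \<in> sigma (space M) E \<rightarrow>\<^sub>M borel"
proof (rule measurableI)
  fix B :: "real set" assume B: "B \<in> sets borel"
  have "(\<lambda>f. f s) -` B \<inter> space (PiM S (\<lambda>_. borel)) \<in> sets (PiM S (\<lambda>_. borel :: real measure))"
    by (rule measurable_sets[OF measurable_component_singleton[OF s] B])
  then have "(\<lambda>\<omega>. \<lambda>s\<in>S. X s \<omega>) -` ((\<lambda>f. f s) -` B \<inter> space (PiM S (\<lambda>_. borel))) \<inter> space M \<in> E"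
    using E(1) unfolding process_events_def by blast
  also have "(\<lambda>\<omega>. \<lambda>s\<in>S. X s \<omega>) -` ((\<lambda>f. f s) -` B \<inter> space (PiM S (\<lambda>_. borel))) \<inter> space M
      = X s -` B \<inter> space M"
    using s by (auto simp: space_PiM)
  finally show "X s -` B \<inter> space (sigma (space M) E) \<in> sets (sigma (space M) E)"
    using E(2) by (simp add: space_measure_of sets_measure_of sigma_sets.Basic)
qed simp

text \<open>
  The sets \<open>R J x\<close> of paths lying below finitely many levels are stable under intersection and
  generate the product $\sigma$-algebra, so laws are determined by the joint distribution functions.
\<close>
lemma process_law_eqI:
  assumes X: "stochastic_process M S X" and Y: "stochastic_process N S Y"
    and eq: "\<And>J x. finite J \<Longrightarrow> J \<subseteq> S \<Longrightarrow>
      emeasure M {\<omega>\<in>space M. \<forall>s\<in>J. X s \<omega> \<le> x s} = emeasure N {\<omega>\<in>space N. \<forall>s\<in>J. Y s \<omega> \<le> x s}"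
  shows "process_law M S X = process_law N S Y"
proof -
  let ?P = "PiM S (\<lambda>_. borel :: real measure)" and ?\<Omega> = "S \<rightarrow>\<^sub>E (UNIV :: real set)"
  define R where "R J x = {f\<in>?\<Omega>. \<forall>s\<in>J. f s \<le> x s}" for J and x :: "_ \<Rightarrow> real"
  let ?G = "{R J x | J x. finite J \<and> J \<subseteq> S}"
  interpret M: prob_space M using X by (simp add: stochastic_process_def)
  have [measurable]: "(\<lambda>\<omega>. \<lambda>s\<in>S. X s \<omega>) \<in> M \<rightarrow>\<^sub>M ?P" "(\<lambda>\<omega>. \<lambda>s\<in>S. Y s \<omega>) \<in> N \<rightarrow>\<^sub>M ?P"
    using X Y by (auto simp: stochastic_process_def intro!: measurable_restrict)
  have space: "space ?P = ?\<Omega>" by (simp add: space_PiM)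
  have G: "?G \<subseteq> Pow ?\<Omega>" by (auto simp: R_def)
  have R_sets: "R J x \<in> sets ?P" if "finite J" "J \<subseteq> S" for J x
  proof -
    have "{f\<in>space ?P. \<forall>s\<in>J. f s \<le> x s} \<in> sets ?P"
      using that by (intro sets.sets_Collect_finite_All' sets.sets_Collect_finite_All)
        (auto intro!: borel_measurable_le[of "\<lambda>f. f _"] measurable_component_singleton)
    then show ?thesis by (simp add: R_def space)
  qed
  have gen: "sets ?P = sigma_sets ?\<Omega> ?G"
  proof
    show "sigma_sets ?\<Omega> ?G \<subseteq> sets ?P"
      unfolding space[symmetric] by (rule sets.sigma_sets_subset) (auto intro: R_sets)
    have "(\<lambda>f s. f s) \<in> sigma ?\<Omega> ?G \<rightarrow>\<^sub>M ?P"
    proof (rule measurable_PiM_single')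
      fix s assume s: "s \<in> S"
      have "{f\<in>?\<Omega>. f s \<le> r} \<in> sigma_sets ?\<Omega> ?G" for r
        using s by (intro sigma_sets.Basic) (auto simp: R_def intro!: exI[of _ "{s}"] exI[of _ "\<lambda>_. r"])
      then show "(\<lambda>f. f s) \<in> borel_measurable (sigma ?\<Omega> ?G)"
        using G by (simp add: borel_measurable_iff_le space_measure_of sets_measure_of)
    qed (use G in \<open>auto simp: space_measure_of\<close>)
    note id = this
    show "sets ?P \<subseteq> sigma_sets ?\<Omega> ?G"
    proof
      fix A assume A: "A \<in> sets ?P"
      have "A \<inter> ?\<Omega> \<in> sigma_sets ?\<Omega> ?G"
        using measurable_sets[OF id A] G by (simp add: space_measure_of sets_measure_of)
      then show "A \<in> sigma_sets ?\<Omega> ?G"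
        using sets.sets_into_space[OF A] by (simp add: space Int_absorb2)
    qed
  qed
  show ?thesis
    unfolding process_law_def
  proof (rule measure_eqI_generator_eq[where E="?G" and \<Omega>="?\<Omega>" and A="\<lambda>_. ?\<Omega>"])
    show "Int_stable ?G"
    proof (rule Int_stableI)
      fix a b assume "a \<in> ?G" "b \<in> ?G"
      then obtain J x K y where J: "finite J" "J \<subseteq> S" "a = R J x" and K: "finite K" "K \<subseteq> S" "b = R K y"
        by auto
      have "a \<inter> b = R (J \<union> K) (\<lambda>s. if s \<in> J \<inter> K then min (x s) (y s) else if s \<in> J then x s else y s)"
        by (auto simp: J K R_def split: if_splits)
      then show "a \<inter> b \<in> ?G" using J K by blast
    qed
    show "?G \<subseteq> Pow ?\<Omega>" by fact
    show "sets (distr M ?P (\<lambda>\<omega>. \<lambda>s\<in>S. X s \<omega>)) = sigma_sets ?\<Omega> ?G"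
      "sets (distr N ?P (\<lambda>\<omega>. \<lambda>s\<in>S. Y s \<omega>)) = sigma_sets ?\<Omega> ?G" by (simp_all add: gen)
    show "range (\<lambda>_::nat. ?\<Omega>) \<subseteq> ?G"
      by (auto simp: R_def intro!: exI[of _ "{}"])
    show "emeasure (distr M ?P (\<lambda>\<omega>. \<lambda>s\<in>S. X s \<omega>)) ?\<Omega> \<noteq> \<infinity>"
      by (subst emeasure_distr) (auto simp: space[symmetric])
    fix B assume "B \<in> ?G"
    then obtain J x where J: "finite J" "J \<subseteq> S" "B = R J x" by auto
    have "(\<lambda>\<omega>. \<lambda>s\<in>S. X s \<omega>) -` R J x \<inter> space M = {\<omega>\<in>space M. \<forall>s\<in>J. X s \<omega> \<le> x s}"
      "(\<lambda>\<omega>. \<lambda>s\<in>S. Y s \<omega>) -` R J x \<inter> space N = {\<omega>\<in>space N. \<forall>s\<in>J. Y s \<omega> \<le> x s}"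
      using J(2) by (auto simp: R_def)
    then show "emeasure (distr M ?P (\<lambda>\<omega>. \<lambda>s\<in>S. X s \<omega>)) B = emeasure (distr N ?P (\<lambda>\<omega>. \<lambda>s\<in>S. Y s \<omega>)) B"
      using J R_sets[OF J(1,2), of x] eq[OF J(1,2), of x] by (simp add: emeasure_distr)
  qed simp
qed

lemma measurable_lp_norm [measurable]:
  assumes [measurable]: "\<And>i. f i \<in> borel_measurable M"
  shows "(\<lambda>\<omega>. lp_norm p (\<lambda>i. f i \<omega>)) \<in> borel_measurable M"
  unfolding lp_norm_def by (cases "p = \<infinity>") simp_all

lemma lp_norm_nonneg: "0 \<le> lp_norm p x"
  by (simp add: lp_norm_def)

text \<open>
  Conditionally on $Z$, the independent events $U(s) Z(s) \le y(s)$ have probabilities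
  $\Phi_p(y(s) / Z(s)) = \exp(- \varphi_p(Z(s) / y(s)))$.
\<close>
lemma (in prob_space) frechet_product_cdf:
  assumes p: "1 < p" and U: "indep_vars (\<lambda>_. borel) U S"
    and cdf: "\<And>s. s \<in> S \<Longrightarrow> cdf (distr M borel (U s)) = frechet_cdf p"
    and J: "finite J" "J \<subseteq> S" and y: "\<And>s. s \<in> J \<Longrightarrow> 0 < y s"
    and indep: "indep_set (sigma_sets (space M) E1) (sigma_sets (space M) E2)"
    and Z: "\<And>s. s \<in> J \<Longrightarrow> Z s \<in> sigma (space M) E1 \<rightarrow>\<^sub>M borel"
    and U_E2: "\<And>s. s \<in> J \<Longrightarrow> U s \<in> sigma (space M) E2 \<rightarrow>\<^sub>M borel"
    and Z0: "\<And>s \<omega>. s \<in> J \<Longrightarrow> 0 \<le> Z s \<omega>"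
  shows "emeasure M {\<omega>\<in>space M. \<forall>s\<in>J. U s \<omega> * Z s \<omega> \<le> y s}
    = (\<integral>\<^sup>+\<omega>. exp_neg (\<Sum>s\<in>J. frechet_exponent p (Z s \<omega> / y s)) \<partial>M)"
proof -
  have U_meas [measurable]: "U s \<in> borel_measurable M" if "s \<in> J" for s
    using U J(2) that by (auto simp: indep_vars_def)
  have Z_meas [measurable]: "Z s \<in> borel_measurable M" if "s \<in> J" for s
    using indep measurable_from_generated(1)[OF _ Z[OF that]] by (auto simp: indep_sets2_eq)
  have single: "(\<integral>\<^sup>+\<omega>. indicator {u. u * z \<le> y s} (U s \<omega>) \<partial>M) = exp_neg (frechet_exponent p (z / y s))"
    if s: "s \<in> J" and z: "0 \<le> z" for s z
  proof (cases "z = 0")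
    case True
    then show ?thesis
      using exp_neg_frechet_exponent[OF p z y[OF s]] y[OF s] by (simp add: emeasure_space_1)
  next
    case False
    then have "{u. u * z \<le> y s} = {.. y s / z}" using z by (auto simp: field_simps)
    then have "(\<integral>\<^sup>+\<omega>. indicator {u. u * z \<le> y s} (U s \<omega>) \<partial>M) = emeasure (distr M borel (U s)) {.. y s / z}"
      using s by (subst nn_integral_indicator[symmetric], simp, subst nn_integral_distr) simp_all
    also have "\<dots> = ennreal (frechet_cdf p (y s / z))"
    proof -
      interpret D: prob_space "distr M borel (U s)" using s by (intro prob_space_distr) simp
      show ?thesis using cdf[of s] s J(2) by (auto simp: D.emeasure_eq_measure cdf_def fun_eq_iff)
    qed
    finally show ?thesis using exp_neg_frechet_exponent[OF p z y[OF s]] False by simp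
  qed
  let ?h = "\<lambda>(z, u). \<Prod>s\<in>J. indicator {v. v \<le> y s} (u s * z s) :: ennreal"
  have "emeasure M {\<omega>\<in>space M. \<forall>s\<in>J. U s \<omega> * Z s \<omega> \<le> y s}
      = (\<integral>\<^sup>+\<omega>. indicator {\<omega>\<in>space M. \<forall>s\<in>J. U s \<omega> * Z s \<omega> \<le> y s} \<omega> \<partial>M)"
    using J(1) by (subst nn_integral_indicator) auto
  also have "\<dots> = (\<integral>\<^sup>+\<omega>. ?h (\<lambda>s\<in>J. Z s \<omega>, \<lambda>s\<in>J. U s \<omega>) \<partial>M)"
  proof (rule nn_integral_cong)
    fix \<omega> assume "\<omega> \<in> space M"
    then show "indicator {\<omega>\<in>space M. \<forall>s\<in>J. U s \<omega> * Z s \<omega> \<le> y s} \<omega> = ?h (\<lambda>s\<in>J. Z s \<omega>, \<lambda>s\<in>J. U s \<omega>)"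
      using J(1) by (auto simp: indicator_def intro!: prod.neutral[symmetric])
  qed
  also have "\<dots> = (\<integral>\<^sup>+\<omega>'. \<integral>\<^sup>+\<omega>. ?h (\<lambda>s\<in>J. Z s \<omega>', \<lambda>s\<in>J. U s \<omega>) \<partial>M \<partial>M)"
  proof (rule indep_set_nn_integral[OF indep])
    show "(\<lambda>\<omega>. \<lambda>s\<in>J. Z s \<omega>) \<in> sigma (space M) E1 \<rightarrow>\<^sub>M PiM J (\<lambda>_. borel)"
      by (rule measurable_restrict) (rule Z)
    show "(\<lambda>\<omega>. \<lambda>s\<in>J. U s \<omega>) \<in> sigma (space M) E2 \<rightarrow>\<^sub>M PiM J (\<lambda>_. borel)"
      by (rule measurable_restrict) (rule U_E2)
  qed measurable
  also have "\<dots> = (\<integral>\<^sup>+\<omega>'. exp_neg (\<Sum>s\<in>J. frechet_exponent p (Z s \<omega>' / y s)) \<partial>M)"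
  proof (rule nn_integral_cong)
    fix \<omega>'
    have "indep_vars (\<lambda>_. borel) (\<lambda>s \<omega>. indicator {u. u * Z s \<omega>' \<le> y s} (U s \<omega>) :: ennreal) J"
      by (rule indep_vars_compose2[OF indep_vars_subset[OF U J(2)]]) auto
    from indep_vars_nn_integral[OF J(1) this]
    have "(\<integral>\<^sup>+\<omega>. (\<Prod>s\<in>J. indicator {u. u * Z s \<omega>' \<le> y s} (U s \<omega>)) \<partial>M)
        = exp_neg (\<Sum>s\<in>J. frechet_exponent p (Z s \<omega>' / y s))"
      by (simp add: exp_neg_sum single Z0)
    then show "(\<integral>\<^sup>+\<omega>. ?h (\<lambda>s\<in>J. Z s \<omega>', \<lambda>s\<in>J. U s \<omega>) \<partial>M)
        = exp_neg (\<Sum>s\<in>J. frechet_exponent p (Z s \<omega>' / y s))"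
      by (simp add: indicator_def)
  qed
  finally show ?thesis .
qed

section \<open>Finite-dimensional distributions of the scaled norm\<close>

lemma measurable_frechet_intensity_ident: "(\<lambda>a. a) \<in> frechet_intensity \<rightarrow>\<^sub>M borel"
proof -
  have "(\<lambda>a. a) \<in> restrict_space borel {0::real<..} \<rightarrow>\<^sub>M borel"
    by (rule measurable_restrict_space1) simp
  then show ?thesis by (simp cong: measurable_cong_sets add: sets_frechet_intensity)
qed

lemma measurable_into_frechet_intensity:
  assumes "X \<in> M \<rightarrow>\<^sub>M borel" "\<And>\<omega>. \<omega> \<in> space M \<Longrightarrow> 0 < X \<omega>"
  shows "X \<in> M \<rightarrow>\<^sub>M frechet_intensity"
proof -
  have "X \<in> M \<rightarrow>\<^sub>M restrict_space borel {0<..}"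
    using assms by (intro measurable_restrict_space2) auto
  then show ?thesis by (simp cong: measurable_cong_sets add: sets_frechet_intensity)
qed

locale random_norm_process = prob_space M
  for M :: "'w measure" +
  fixes S :: "'s set" and p :: ereal and N :: "'v measure"
    and U :: "'s \<Rightarrow> 'w \<Rightarrow> real" and A :: "nat \<Rightarrow> 'w \<Rightarrow> real"
    and W :: "'s \<Rightarrow> 'v \<Rightarrow> real" and Wi :: "nat \<Rightarrow> 's \<Rightarrow> 'w \<Rightarrow> real"
  assumes p: "1 < p"
    and U_indep: "indep_vars (\<lambda>_. borel) U S"
    and U_cdf: "\<And>s. s \<in> S \<Longrightarrow> cdf (distr M borel (U s)) = frechet_cdf p"
    and A_pos: "\<And>i \<omega>. \<omega> \<in> space M \<Longrightarrow> 0 < A i \<omega>"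
    and A_ppp: "poisson_point_process M frechet_intensity (dirac_sum A)"
    and W_process: "stochastic_process N S W"
    and W_nonneg: "\<And>s \<omega>. s \<in> S \<Longrightarrow> \<omega> \<in> space N \<Longrightarrow> 0 \<le> W s \<omega>"
    and W_mean: "\<And>s. s \<in> S \<Longrightarrow> integrable N (W s) \<and> (\<integral>\<omega>. W s \<omega> \<partial>N) = 1"
    and Wi_copies: "independent_copies M S Wi N W"
    and indep: "indep_sets
      (\<lambda>k. [process_events M S U,
            process_events M UNIV A,
            process_events M (UNIV \<times> S) (\<lambda>(i, s). Wi i s)] ! k) {..<3}"
begin

abbreviation "A_events \<equiv> process_events M UNIV A"
abbreviation "W_events \<equiv> process_events M (UNIV \<times> S) (\<lambda>(i, s). Wi i s)"

text \<open>
  The joint independence of the three families is used in two pairs: the marks are integrated out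
  given the points, and $U$ is integrated out given points and marks.
\<close>
lemma indep_A_W: "indep_set (sigma_sets (space M) A_events) (sigma_sets (space M) W_events)"
proof -
  let ?E = "\<lambda>k. [process_events M S U, A_events, W_events] ! k"
  have "indep_sets (\<lambda>j. sigma_sets (space M) (\<Union>k\<in>case_bool {1} {2} j. ?E k)) UNIV"
    by (rule indep_sets_collect_sigma[OF indep_sets_mono_index[OF _ indep]])
       (auto simp: disjoint_family_on_def UNIV_bool Int_stable_process_events split: bool.splits)
  then show ?thesis
    unfolding indep_set_def by (elim indep_sets_mono_sets) (auto split: bool.splits)
qed

lemma indep_AW_U:
  "indep_set (sigma_sets (space M) (A_events \<union> W_events)) (sigma_sets (space M) (process_events M S U))"
proof -
  let ?E = "\<lambda>k. [process_events M S U, A_events, W_events] ! k"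
  have "indep_sets (\<lambda>j. sigma_sets (space M) (\<Union>k\<in>case_bool {1, 2} {0} j. ?E k)) UNIV"
    by (rule indep_sets_collect_sigma[OF indep_sets_mono_index[OF _ indep]])
       (auto simp: disjoint_family_on_def UNIV_bool Int_stable_process_events split: bool.splits)
  then show ?thesis
    unfolding indep_set_def by (elim indep_sets_mono_sets) (auto split: bool.splits)
qed

lemma A_generated: "A_events \<subseteq> E \<Longrightarrow> E \<subseteq> Pow (space M) \<Longrightarrow> A i \<in> sigma (space M) E \<rightarrow>\<^sub>M borel"
  by (rule measurable_process_events[of i UNIV]) auto

lemma Wi_generated:
  "W_events \<subseteq> E \<Longrightarrow> E \<subseteq> Pow (space M) \<Longrightarrow> s \<in> S \<Longrightarrow> Wi i s \<in> sigma (space M) E \<rightarrow>\<^sub>M borel"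
  using measurable_process_events[of "(i, s)" "UNIV \<times> S" M "\<lambda>(i, s). Wi i s" E] by simp

lemma U_generated: "s \<in> S \<Longrightarrow> U s \<in> sigma (space M) (process_events M S U) \<rightarrow>\<^sub>M borel"
  by (rule measurable_process_events[OF _ order_refl process_events_subset])

lemma A_measurable [measurable]: "A i \<in> borel_measurable M"
  using indep_A_W measurable_from_generated(1)[OF _ A_generated[OF order_refl process_events_subset]]
  by (auto simp: indep_sets2_eq)

lemma Wi_measurable [measurable]: "s \<in> S \<Longrightarrow> Wi i s \<in> borel_measurable M"
  using indep_A_W measurable_from_generated(1)[OF _ Wi_generated[OF order_refl process_events_subset]]
  by (auto simp: indep_sets2_eq)

lemma U_measurable [measurable]: "s \<in> S \<Longrightarrow> U s \<in> borel_measurable M"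
  using U_indep by (auto simp: indep_vars_def)

lemma W_measurable [measurable]: "s \<in> S \<Longrightarrow> W s \<in> borel_measurable N"
  using W_process by (auto simp: stochastic_process_def)

definition \<gamma> :: real where "\<gamma> = Gamma (1 - real_of_ereal (inverse p))"

lemma \<gamma>_pos: "0 < \<gamma>"
proof -
  have "real_of_ereal (inverse p) < 1"
    using p by (cases p) (auto simp: field_simps)
  then show ?thesis by (simp add: \<gamma>_def Gamma_real_pos)
qed

definition norm_process :: "'s \<Rightarrow> 'w \<Rightarrow> real" where "norm_process s \<omega> = lp_norm p (\<lambda>i. A i \<omega> * Wi i s \<omega>)"

definition X :: "'s \<Rightarrow> 'w \<Rightarrow> real" where "X s \<omega> = U s \<omega> / \<gamma> * norm_process s \<omega>"

lemma X_measurable [measurable]: "s \<in> S \<Longrightarrow> X s \<in> borel_measurable M"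
  unfolding X_def norm_process_def by measurable

text \<open>
  The contribution of a point $a$ with mark $w$ to the exponent of the conditional probability of
  $X(s) \le x(s)$, $s \in J$, given points and marks.
\<close>
definition point_exponent :: "'s set \<Rightarrow> ('s \<Rightarrow> real) \<Rightarrow> real \<Rightarrow> ('s \<Rightarrow> real) \<Rightarrow> ennreal" where
  "point_exponent J x a w = (\<Sum>s\<in>J. frechet_exponent p (a * w s / (\<gamma> * x s)))"

text \<open>The function $V_J$ with $P(X(s) \le x(s), s \in J) = \exp(- V_J(x))$; see \<open>joint_cdf\<close>.\<close>
definition exponent_function :: "'s set \<Rightarrow> ('s \<Rightarrow> real) \<Rightarrow> ennreal" where
  "exponent_function J x = (\<integral>\<^sup>+w. \<integral>\<^sup>+a. 1 - exp_neg (point_exponent J x a w) \<partial>frechet_intensity \<partial>process_law N S W)"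

lemma point_exponent_measurable:
  assumes "J \<subseteq> S" and f: "f \<in> borel_measurable L" and g: "g \<in> L \<rightarrow>\<^sub>M PiM S (\<lambda>_. borel)"
  shows "(\<lambda>z. point_exponent J x (f z) (g z)) \<in> borel_measurable L"
proof -
  have "(\<lambda>z. g z s) \<in> borel_measurable L" if "s \<in> J" for s
    by (rule measurable_compose[OF g measurable_component_singleton]) (use that assms(1) in auto)
  then show ?thesis
    unfolding point_exponent_def using f
    by (intro borel_measurable_sum measurable_compose[OF _ measurable_frechet_exponent]
        borel_measurable_divide borel_measurable_times) auto
qed

lemma inner_integral_measurable:
  assumes "J \<subseteq> S"
  shows "(\<lambda>w. \<integral>\<^sup>+a. 1 - exp_neg (point_exponent J x a w) \<partial>frechet_intensity) \<in> borel_measurable (PiM S (\<lambda>_. borel))"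
proof -
  interpret sigma_finite_measure frechet_intensity by (rule sigma_finite_frechet_intensity)
  have "(\<lambda>z. point_exponent J x (snd z) (fst z)) \<in> borel_measurable (PiM S (\<lambda>_. borel) \<Otimes>\<^sub>M frechet_intensity)"
    by (rule point_exponent_measurable[OF assms measurable_compose[OF measurable_snd measurable_frechet_intensity_ident]]) simp
  then show ?thesis
    by (intro borel_measurable_nn_integral) (simp add: split_beta')
qed

lemma exponent_laplace:
  assumes J: "finite J" "J \<subseteq> S"
  shows "(\<integral>\<^sup>+\<omega>. exp_neg (\<Sum>i. point_exponent J x (A i \<omega>) (\<lambda>s\<in>S. Wi i s \<omega>)) \<partial>M) = exp_neg (exponent_function J x)"
  unfolding exponent_function_def
proof (rule marked_poisson_exp_neg[where K="PiM S (\<lambda>_. borel)"])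
  show "poisson_point_process M frechet_intensity (dirac_sum A)" by (rule A_ppp)
  show "sigma_finite_measure frechet_intensity" by (rule sigma_finite_frechet_intensity)
  show "indep_vars (\<lambda>_. PiM S (\<lambda>_. borel)) (\<lambda>i \<omega>. \<lambda>s\<in>S. Wi i s \<omega>) UNIV"
    using Wi_copies by (simp add: independent_copies_def)
  show "distr M (PiM S (\<lambda>_. borel)) (\<lambda>\<omega>. \<lambda>s\<in>S. Wi i s \<omega>) = process_law N S W" for i
    using Wi_copies by (simp add: independent_copies_def process_law_def)
  show "indep_set (sigma_sets (space M) A_events) (sigma_sets (space M) W_events)"
    by (rule indep_A_W)
  show "A i \<in> sigma (space M) A_events \<rightarrow>\<^sub>M frechet_intensity" for i
    using A_pos process_events_subset[of M UNIV A]
    by (intro measurable_into_frechet_intensity A_generated) (auto simp: space_measure_of)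
  show "(\<lambda>\<omega>. \<lambda>s\<in>S. Wi i s \<omega>) \<in> sigma (space M) W_events \<rightarrow>\<^sub>M PiM S (\<lambda>_. borel)" for i
    by (rule measurable_restrict) (rule Wi_generated[OF order_refl process_events_subset])
  show "(\<lambda>(a, w). point_exponent J x a w) \<in> borel_measurable (frechet_intensity \<Otimes>\<^sub>M PiM S (\<lambda>_. borel))"
    unfolding split_beta'
    by (rule point_exponent_measurable[OF J(2) measurable_compose[OF measurable_fst measurable_frechet_intensity_ident]]) simp
qed

lemma exponent_function_scale:
  assumes J: "J \<subseteq> S" and t: "0 < t"
  shows "exponent_function J (\<lambda>s. t * x s) = ennreal (1 / t) * exponent_function J x"
proof -
  have point: "point_exponent J (\<lambda>s. t * x s) a w = point_exponent J x (1 / t * a) w" for a w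
    using t by (simp add: point_exponent_def field_simps)
  have F_meas [measurable]: "(\<lambda>a. point_exponent J x a w) \<in> borel_measurable borel" for w
    unfolding point_exponent_def by measurable
  have "(\<integral>\<^sup>+a. 1 - exp_neg (point_exponent J (\<lambda>s. t * x s) a w) \<partial>frechet_intensity)
      = ennreal (1 / t) * (\<integral>\<^sup>+a. 1 - exp_neg (point_exponent J x a w) \<partial>frechet_intensity)" for w
    unfolding point using t by (intro nn_integral_frechet_intensity_scale) auto
  then show ?thesis
    unfolding exponent_function_def using inner_integral_measurable[OF J]
    by (simp add: nn_integral_cmult process_law_def)
qed

text \<open>
  Dilating by $v = W(s) / (\gamma x(s))$ takes $v$ out of the inner integral, and the remaining
  integral is $\gamma$; so the inner integral is $W(s) / x(s)$, with mean $1 / x(s)$.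
\<close>
lemma exponent_function_single:
  assumes s: "s \<in> S" and x: "0 < x s"
  shows "exponent_function {s} x = ennreal (1 / x s)"
proof -
  have inner: "(\<integral>\<^sup>+a. 1 - exp_neg (point_exponent {s} x a w) \<partial>frechet_intensity) = ennreal (w s / x s)" if w: "0 \<le> w s" for w
  proof (cases "w s = 0")
    case True
    have "frechet_exponent p 0 = 0" using p by (auto simp: frechet_exponent_def dest: real_of_ereal_gt_1)
    then show ?thesis by (simp add: point_exponent_def True)
  next
    case False
    define v where "v = w s / (\<gamma> * x s)"
    have v: "0 < v" using w x \<gamma>_pos False by (simp add: v_def)
    have "(\<integral>\<^sup>+a. 1 - exp_neg (point_exponent {s} x a w) \<partial>frechet_intensity)
        = (\<integral>\<^sup>+a. 1 - exp_neg (frechet_exponent p (v * a)) \<partial>frechet_intensity)"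
      by (simp add: point_exponent_def v_def mult.commute)
    also have "\<dots> = ennreal v * ennreal \<gamma>"
      using nn_integral_frechet_intensity_scale[OF _ v, of "\<lambda>a. 1 - exp_neg (frechet_exponent p a)"]
        nn_integral_frechet_exponent[OF p] by (simp add: \<gamma>_def)
    also have "\<dots> = ennreal (w s / x s)" using v \<gamma>_pos x by (simp add: v_def flip: ennreal_mult')
    finally show ?thesis .
  qed
  have "exponent_function {s} x = (\<integral>\<^sup>+\<omega>. (\<integral>\<^sup>+a. 1 - exp_neg (point_exponent {s} x a (\<lambda>s\<in>S. W s \<omega>)) \<partial>frechet_intensity) \<partial>N)"
    unfolding exponent_function_def process_law_def
    by (rule nn_integral_distr) (auto intro!: measurable_restrict simp: inner_integral_measurable s)
  also have "\<dots> = (\<integral>\<^sup>+\<omega>. ennreal (W s \<omega> / x s) \<partial>N)"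
    using s W_nonneg by (intro nn_integral_cong) (simp add: inner)
  also have "\<dots> = ennreal (\<integral>\<omega>. W s \<omega> / x s \<partial>N)"
    using W_mean[OF s] W_nonneg[OF s] x by (intro nn_integral_eq_integral) auto
  also have "\<dots> = ennreal (1 / x s)" using W_mean[OF s] by simp
  finally show ?thesis .
qed

text \<open>
  The copies share only the law of $W$, hence they inherit its non-negativity almost surely, not everywhere.
\<close>
lemma AE_Wi_nonneg:
  assumes s: "s \<in> S"
  shows "AE \<omega> in M. \<forall>i. 0 \<le> Wi i s \<omega>"
  unfolding AE_all_countable
proof
  fix i
  let ?P = "PiM S (\<lambda>_. borel :: real measure)"
  have [measurable]: "(\<lambda>\<omega>. \<lambda>s\<in>S. Wi i s \<omega>) \<in> M \<rightarrow>\<^sub>M ?P" "(\<lambda>\<omega>. \<lambda>s\<in>S. W s \<omega>) \<in> N \<rightarrow>\<^sub>M ?P"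
    by (auto intro!: measurable_restrict)
  have [measurable]: "{w\<in>space ?P. 0 \<le> w s} \<in> sets ?P"
    by (intro borel_measurable_le measurable_component_singleton s) simp
  have "AE \<omega> in N. 0 \<le> (\<lambda>s\<in>S. W s \<omega>) s" using s W_nonneg by (intro AE_I2) simp
  then have "AE w in distr N ?P (\<lambda>\<omega>. \<lambda>s\<in>S. W s \<omega>). 0 \<le> w s" by (subst AE_distr_iff) auto
  also have "distr N ?P (\<lambda>\<omega>. \<lambda>s\<in>S. W s \<omega>) = distr M ?P (\<lambda>\<omega>. \<lambda>s\<in>S. Wi i s \<omega>)"
    using Wi_copies by (simp add: independent_copies_def process_law_def)
  finally show "AE \<omega> in M. 0 \<le> Wi i s \<omega>" using s by (subst (asm) AE_distr_iff) auto
qed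

text \<open>
  If $\Sigma$ is the series of exponents at scale $\gamma y$, then $E(e^{-\Sigma}) = \exp(- 1 / y)$
  tends to $1$ as $y \to \infty$; but it is at most the probability that the series is finite at
  some scale.
\<close>
lemma AE_norm_finite:
  assumes s: "s \<in> S"
  shows "AE \<omega> in M. \<exists>y>0. (\<Sum>i. frechet_exponent p (A i \<omega> * Wi i s \<omega> / y)) < \<top>"
proof -
  define T where "T n \<omega> = (\<Sum>i. frechet_exponent p (A i \<omega> * Wi i s \<omega> / (\<gamma> * real (Suc n))))" for n \<omega>
  have [measurable]: "T n \<in> borel_measurable M" for n unfolding T_def using s by measurable
  define G where "G = {\<omega>\<in>space M. \<exists>n. T n \<omega> < \<top>}"
  have [measurable]: "G \<in> sets M" unfolding G_def by measurable
  have le: "ennreal (exp (- (1 / real (Suc n)))) \<le> emeasure M G" for n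
  proof -
    have "ennreal (exp (- (1 / real (Suc n)))) = exp_neg (exponent_function {s} (\<lambda>_. real (Suc n)))"
      by (simp add: exponent_function_single s exp_neg_ennreal)
    also have "\<dots> = (\<integral>\<^sup>+\<omega>. exp_neg (T n \<omega>) \<partial>M)"
      using s by (subst exponent_laplace[symmetric]) (auto simp: point_exponent_def T_def)
    also have "\<dots> \<le> (\<integral>\<^sup>+\<omega>. indicator G \<omega> \<partial>M)"
    proof (rule nn_integral_mono)
      fix \<omega> assume "\<omega> \<in> space M"
      then show "exp_neg (T n \<omega>) \<le> indicator G \<omega>"
        using exp_neg_le_1[of "T n \<omega>"] by (cases "T n \<omega> = \<top>") (auto simp: G_def indicator_def less_top)
    qed
    finally show ?thesis by simp
  qed
  have "(\<lambda>n. exp (- (1 / real (Suc n)))) \<longlonglongrightarrow> exp (- 0)"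
    by (intro tendsto_intros LIMSEQ_Suc lim_1_over_n)
  from LIMSEQ_le_const2[OF this, of "prob G"] have "1 \<le> prob G"
    using le by (auto simp: emeasure_eq_measure)
  then have "prob G = 1" by (simp add: antisym)
  then have "AE \<omega> in M. \<omega> \<in> G" by (subst AE_in_set_eq_1) auto
  then show ?thesis
  proof eventually_elim
    case (elim \<omega>)
    then obtain n where "T n \<omega> < \<top>" by (auto simp: G_def)
    then show ?case using \<gamma>_pos by (intro exI[of _ "\<gamma> * real (Suc n)"]) (auto simp: T_def)
  qed
qed

text \<open>
  After integrating out $U$, the exponent is a sum over $s$ of exponents of norms; expanding each norm over the
  points and exchanging the sums gives a sum over the marked points, to which the Laplace
  functional applies.
\<close>
lemma joint_cdf:
  assumes J: "finite J" "J \<subseteq> S" and x: "\<And>s. s \<in> J \<Longrightarrow> 0 < x s"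
  shows "emeasure M {\<omega>\<in>space M. \<forall>s\<in>J. X s \<omega> \<le> x s} = exp_neg (exponent_function J x)"
proof -
  let ?E = "A_events \<union> W_events"
  have E: "?E \<subseteq> Pow (space M)" by (simp add: process_events_subset)
  have "X s \<omega> \<le> x s \<longleftrightarrow> U s \<omega> * norm_process s \<omega> \<le> \<gamma> * x s" for s \<omega>
    using \<gamma>_pos by (simp add: X_def field_simps)
  then have "emeasure M {\<omega>\<in>space M. \<forall>s\<in>J. X s \<omega> \<le> x s}
      = emeasure M {\<omega>\<in>space M. \<forall>s\<in>J. U s \<omega> * norm_process s \<omega> \<le> \<gamma> * x s}" by simp
  also have "\<dots> = (\<integral>\<^sup>+\<omega>. exp_neg (\<Sum>s\<in>J. frechet_exponent p (norm_process s \<omega> / (\<gamma> * x s))) \<partial>M)"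
  proof (rule frechet_product_cdf[OF p U_indep U_cdf J _ indep_AW_U])
    show "norm_process s \<in> sigma (space M) ?E \<rightarrow>\<^sub>M borel" if "s \<in> J" for s
      unfolding norm_process_def using J(2) that E
      by (intro measurable_lp_norm borel_measurable_times A_generated Wi_generated) auto
  qed (use J(2) x \<gamma>_pos U_generated in \<open>auto simp: norm_process_def lp_norm_nonneg\<close>)
  also have "\<dots> = (\<integral>\<^sup>+\<omega>. exp_neg (\<Sum>i. point_exponent J x (A i \<omega>) (\<lambda>s\<in>S. Wi i s \<omega>)) \<partial>M)"
  proof (rule nn_integral_cong_AE)
    have "AE \<omega> in M. \<forall>s\<in>J. (\<forall>i. 0 \<le> Wi i s \<omega>)
        \<and> (\<exists>y>0. (\<Sum>i. frechet_exponent p (A i \<omega> * Wi i s \<omega> / y)) < \<top>)"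
      using J AE_Wi_nonneg AE_norm_finite by (intro AE_finite_allI) auto
    then show "AE \<omega> in M. exp_neg (\<Sum>s\<in>J. frechet_exponent p (norm_process s \<omega> / (\<gamma> * x s)))
        = exp_neg (\<Sum>i. point_exponent J x (A i \<omega>) (\<lambda>s\<in>S. Wi i s \<omega>))"
      using AE_space
    proof eventually_elim
      case (elim \<omega>)
      have "frechet_exponent p (norm_process s \<omega> / (\<gamma> * x s))
          = (\<Sum>i. frechet_exponent p (A i \<omega> * (\<lambda>s\<in>S. Wi i s \<omega>) s / (\<gamma> * x s)))" if s: "s \<in> J" for s
      proof -
        obtain y where y: "0 < y" "(\<Sum>i. frechet_exponent p (A i \<omega> * Wi i s \<omega> / y)) < \<top>"
          using elim(1) s by blast
        have "0 \<le> A i \<omega> * Wi i s \<omega>" for i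
          using elim s A_pos[of \<omega> i] by (intro mult_nonneg_nonneg) auto
        from suminf_frechet_exponent[OF p this _ y] show ?thesis
          using s J(2) x \<gamma>_pos by (auto simp: norm_process_def subset_eq)
      qed
      then have "(\<Sum>s\<in>J. frechet_exponent p (norm_process s \<omega> / (\<gamma> * x s)))
          = (\<Sum>s\<in>J. \<Sum>i. frechet_exponent p (A i \<omega> * (\<lambda>s\<in>S. Wi i s \<omega>) s / (\<gamma> * x s)))"
        by (intro sum.cong) auto
      also have "\<dots> = (\<Sum>i. point_exponent J x (A i \<omega>) (\<lambda>s\<in>S. Wi i s \<omega>))"
        unfolding point_exponent_def by (rule suminf_sum[symmetric]) simp
      finally show ?case by simp
    qed
  qed
  also have "\<dots> = exp_neg (exponent_function J x)" by (rule exponent_laplace[OF J])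
  finally show ?thesis .
qed

lemma cdf_pos:
  assumes "s \<in> S" "0 < x"
  shows "emeasure M {\<omega>\<in>space M. X s \<omega> \<le> x} = ennreal (exp (- (1 / x)))"
  using joint_cdf[of "{s}" "\<lambda>_. x"] assms by (simp add: exponent_function_single exp_neg_ennreal)

text \<open>Let $y$ decrease to $0$ in $P(X(s) \le y) = \exp(- 1 / y)$.\<close>
lemma cdf_nonpos:
  assumes s: "s \<in> S" and x: "x \<le> 0"
  shows "emeasure M {\<omega>\<in>space M. X s \<omega> \<le> x} = 0"
proof -
  have le: "prob {\<omega>\<in>space M. X s \<omega> \<le> x} \<le> exp (- real (Suc n))" for n
  proof -
    have "emeasure M {\<omega>\<in>space M. X s \<omega> \<le> x} \<le> emeasure M {\<omega>\<in>space M. X s \<omega> \<le> 1 / real (Suc n)}"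
      using s x by (intro emeasure_mono) (auto intro: order_trans[of _ 0])
    then show ?thesis
      using cdf_pos[OF s, of "1 / real (Suc n)"] by (simp add: emeasure_eq_measure)
  qed
  have "(\<lambda>n. exp (- real (Suc n))) \<longlonglongrightarrow> 0"
    by (intro filterlim_compose[OF exp_at_bot] filterlim_compose[OF filterlim_uminus_at_bot_at_top]
        filterlim_compose[OF filterlim_real_sequentially filterlim_Suc])
  from LIMSEQ_le_const[OF this, of "prob {\<omega>\<in>space M. X s \<omega> \<le> x}"]
  have "prob {\<omega>\<in>space M. X s \<omega> \<le> x} \<le> 0" using le by auto
  then show ?thesis by (simp add: emeasure_eq_measure measure_le_0_iff)
qed

text \<open>
  For positive levels this is homogeneity, $n V_J(n x) = V_J(x)$. If some level is not positive, then
  both sides vanish because $X$ is almost surely positive there.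
\<close>
lemma joint_cdf_power:
  assumes J: "finite J" "J \<subseteq> S" and n: "1 \<le> n"
  shows "emeasure M {\<omega>\<in>space M. \<forall>s\<in>J. X s \<omega> \<le> real n * x s} ^ n
    = emeasure M {\<omega>\<in>space M. \<forall>s\<in>J. X s \<omega> \<le> x s}"
proof (cases "\<forall>s\<in>J. 0 < x s")
  case True
  have "ennreal (real n) * ennreal (1 / real n) = 1" using n by (simp flip: ennreal_mult)
  then have "of_nat n * (ennreal (1 / real n) * exponent_function J x) = exponent_function J x"
    by (simp add: mult.assoc[symmetric] ennreal_of_nat_eq_real_of_nat)
  then have "exp_neg (\<Sum>i<n. ennreal (1 / real n) * exponent_function J x) = exp_neg (exponent_function J x)" by simp
  then show ?thesis
    using True n by (simp add: joint_cdf[OF J] exponent_function_scale[OF J(2)] exp_neg_sum del: sum_constant)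
next
  case False
  then obtain s where s: "s \<in> J" "x s \<le> 0" by auto
  have zero: "emeasure M {\<omega>\<in>space M. \<forall>s\<in>J. X s \<omega> \<le> y s} = 0" if "y s \<le> 0" for y
  proof -
    have "emeasure M {\<omega>\<in>space M. \<forall>s\<in>J. X s \<omega> \<le> y s} \<le> emeasure M {\<omega>\<in>space M. X s \<omega> \<le> y s}"
      using s J(2) by (intro emeasure_mono) auto
    then show ?thesis using cdf_nonpos[of s "y s"] s J(2) that by auto
  qed
  show ?thesis
    using n s zero[of x] zero[of "\<lambda>s. real n * x s"] by (simp add: mult_nonneg_nonpos)
qed

text \<open>
  The $n$-fold maximum lies below the levels $x(s)$ iff all $n$ independent coordinates of the product space lie
  below $n x(s)$, which has the $n$-th power of the probability of one coordinate. The norming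
  constants are the scale $n$ and the location $0$.
\<close>
lemma process_law_max:
  assumes n: "1 \<le> n"
  shows "process_law (PiM {1..n} (\<lambda>_. M)) S (\<lambda>s \<omega>. MAX i\<in>{1..n}. (X s (\<omega> i) - 0) / real n) = process_law M S X"
proof (rule process_law_eqI)
  interpret P: product_prob_space "\<lambda>_. M" "{1..n}" ..
  have comp [measurable]: "(\<lambda>\<omega>. X s (\<omega> i)) \<in> borel_measurable (PiM {1..n} (\<lambda>_. M))"
    if "s \<in> S" "i \<in> {1..n}" for s i
    by (rule measurable_compose[OF measurable_component_singleton[OF that(2)] X_measurable[OF that(1)]])
  show "stochastic_process (PiM {1..n} (\<lambda>_. M)) S (\<lambda>s \<omega>. MAX i\<in>{1..n}. (X s (\<omega> i) - 0) / real n)"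
    unfolding stochastic_process_def using n P.prob_space_axioms
    by (auto intro!: borel_measurable_Max)
  show "stochastic_process M S X"
    by (simp add: stochastic_process_def prob_space_axioms)
  fix J and x :: "'s \<Rightarrow> real" assume J: "finite J" "J \<subseteq> S"
  let ?B = "{\<omega>\<in>space M. \<forall>s\<in>J. X s \<omega> \<le> real n * x s}"
  have B: "?B \<in> sets M"
    using J by (intro sets.sets_Collect_finite_All' sets.sets_Collect_finite_All borel_measurable_le) auto
  have "(MAX i\<in>{1..n}. (X s (\<omega> i) - 0) / real n) \<le> x s \<longleftrightarrow> (\<forall>i\<in>{1..n}. X s (\<omega> i) \<le> real n * x s)" for s \<omega>
    using n by (subst Max_le_iff) (auto simp: field_simps)
  then have "{\<omega>\<in>space (PiM {1..n} (\<lambda>_. M)). \<forall>s\<in>J. (MAX i\<in>{1..n}. (X s (\<omega> i) - 0) / real n) \<le> x s}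
      = {\<omega>\<in>space (PiM {1..n} (\<lambda>_. M)). \<forall>s\<in>J. \<forall>i\<in>{1..n}. X s (\<omega> i) \<le> real n * x s}"
    by (simp only:)
  also have "\<dots> = Pi\<^sub>E {1..n} (\<lambda>_. ?B)"
    unfolding space_PiM by (intro set_eqI) (simp only: mem_Collect_eq PiE_iff, blast)
  finally have "emeasure (PiM {1..n} (\<lambda>_. M)) {\<omega>\<in>space (PiM {1..n} (\<lambda>_. M)). \<forall>s\<in>J. (MAX i\<in>{1..n}. (X s (\<omega> i) - 0) / real n) \<le> x s}
      = emeasure M ?B ^ n"
    using B by (simp add: P.emeasure_PiM)
  then show "emeasure (PiM {1..n} (\<lambda>_. M)) {\<omega>\<in>space (PiM {1..n} (\<lambda>_. M)). \<forall>s\<in>J. (MAX i\<in>{1..n}. (X s (\<omega> i) - 0) / real n) \<le> x s}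
      = emeasure M {\<omega>\<in>space M. \<forall>s\<in>J. X s \<omega> \<le> x s}"
    using joint_cdf_power[OF J n] by simp
qed

lemma simple_max_stable_X: "simple_max_stable M S X"
  unfolding simple_max_stable_def max_stable_def
proof (intro conjI ballI)
  show "stochastic_process M S X"
    by (simp add: stochastic_process_def prob_space_axioms)
  show "\<exists>(a :: nat \<Rightarrow> 's \<Rightarrow> real) (b :: nat \<Rightarrow> 's \<Rightarrow> real). \<forall>n\<ge>1. (\<forall>s\<in>S. 0 < a n s) \<and>
      process_law (PiM {1..n} (\<lambda>_. M)) S (\<lambda>s \<omega>. MAX i\<in>{1..n}. (X s (\<omega> i) - b n s) / a n s) = process_law M S X"
    by (rule exI[of _ "\<lambda>(n :: nat) (_ :: 's). real n"], rule exI[of _ "\<lambda>(_ :: nat) (_ :: 's). 0"])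
       (intro allI impI conjI process_law_max, auto)
  fix s assume s: "s \<in> S"
  show "cdf (distr M borel (X s)) = frechet_cdf 1"
  proof
    fix x
    have "X s -` {..x} \<inter> space M = {\<omega>\<in>space M. X s \<omega> \<le> x}" by auto
    then have "cdf (distr M borel (X s)) x = prob {\<omega>\<in>space M. X s \<omega> \<le> x}"
      using s by (simp add: cdf_def measure_distr)
    then show "cdf (distr M borel (X s)) x = frechet_cdf 1 x"
      using cdf_pos[OF s, of x] cdf_nonpos[OF s, of x]
      by (cases "0 < x") (auto simp: frechet_cdf_def emeasure_eq_measure powr_minus_divide)
  qed
qed

end

theorem theorem1:
  fixes S :: "'s set" and p :: ereal
    and M :: "'w measure" and N :: "'v measure"
    and U :: "'s \<Rightarrow> 'w \<Rightarrow> real"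
    and A :: "nat \<Rightarrow> 'w \<Rightarrow> real"
    and W :: "'s \<Rightarrow> 'v \<Rightarrow> real"
    and Wi :: "nat \<Rightarrow> 's \<Rightarrow> 'w \<Rightarrow> real"
  assumes "countable S" and "1 < p"
    and "prob_space M"
    and U_indep: "prob_space.indep_vars M (\<lambda>_. borel) U S"
    and U_cdf: "\<forall>s\<in>S. cdf (distr M borel (U s)) = frechet_cdf p"
    and A_meas: "\<forall>i. A i \<in> borel_measurable M"
    and A_pos: "\<forall>i. \<forall>\<omega>\<in>space M. 0 < A i \<omega>"
    and A_ppp: "poisson_point_process M frechet_intensity (dirac_sum A)"
    and W_process: "stochastic_process N S W"
    and W_nonneg: "\<forall>s\<in>S. \<forall>\<omega>\<in>space N. 0 \<le> W s \<omega>"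
    and W_mean: "\<forall>s\<in>S. integrable N (W s) \<and> (\<integral>\<omega>. W s \<omega> \<partial>N) = 1"
    and Wi_copies: "independent_copies M S Wi N W"
    and indep: "prob_space.indep_sets M
      (\<lambda>k. [process_events M S U,
            process_events M UNIV A,
            process_events M (UNIV \<times> S) (\<lambda>(i, s). Wi i s)] ! k) {..<3}"
  shows "simple_max_stable M S
    (\<lambda>s \<omega>. U s \<omega> / Gamma (1 - real_of_ereal (inverse p)) * lp_norm p (\<lambda>i. A i \<omega> * Wi i s \<omega>))"
proof -
  interpret random_norm_process M S p N U A W Wi
    by (rule random_norm_process.intro, fact, unfold_locales) (use assms in auto)
  show ?thesis
    using simple_max_stable_X unfolding X_def norm_process_def \<gamma>_def .
qed

end
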